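(* For every $\frac{6}{5}<\delta<2$, $\alpha_{*}(\delta,2)\leq 1+\sqrt{(\delta-1)(3-\delta)}$.
   Context: Let $G\sim G(n,\frac12)$ be a random graph on a vertex set $V$ with $|V|=n$; logarithms are base 2. An algorithm accesses $G$ only through edge queries: querying an unordered pair $\{u,v\}$ of distinct vertices reveals whether $\{u,v\}$ is an edge of $G$. An $l$-round algorithm is deterministic and proceeds in $l$ rounds; in round $i$ it submits a set of pairs chosen as a function of the answers received in rounds $1,\dots,i-1$ (but not of answers in round $i$), and all of them are answered together. Let $G'$ be the graph on $V$ whose edges are the queried pairs answered positively. For $l\in\mathbb N$, $1\le\delta<2$ and $\alpha\le 2$, a $(\delta,l,\alpha)$-algorithm is an $l$-round algorithm making at most $n^{\delta}$ queries in each round such that for every sufficiently large $n$, with probability at least $\frac12$ (over $G$), $G'$ contains a clique of size at least $\alpha\log n-o(\log n)$. $\alpha_*(\delta,l)$ is the supremum of $\alpha$ for which a $(\delta,l,\alpha)$-algorithm exists. *)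

theory Defs
  imports "HOL-Probability.Probability" "HOL-Library.Ramsey" "HOL-Library.Landau_Symbols"
begin

text \<open>A graph on the vertex set \<open>{..<n}\<close> is represented by its edge set, a set of
  2-element subsets of \<open>{..<n}\<close>.\<close>

type_synonym edge_set = "nat set set"

definition random_graph :: "nat \<Rightarrow> real \<Rightarrow> edge_set pmf" where
  "random_graph n p =
     map_pmf (\<lambda>f. {e \<in> nsets {..<n} 2. f e})
       (Pi_pmf (nsets {..<n} 2) False (\<lambda>_. bernoulli_pmf p))"

text \<open>A deterministic strategy maps the answers of the previous rounds to the set of pairs queried
  in the next round. The answers of a round are recorded as the set of those queried pairs
  that are edges; which pairs were queried need not be recorded, since for a deterministic strategy
  this is determined by the earlier answers.\<close>

type_synonym strategy = "edge_set list \<Rightarrow> edge_set"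

primrec answers :: "strategy \<Rightarrow> edge_set \<Rightarrow> nat \<Rightarrow> edge_set list" where
  "answers S G 0 = []"
| "answers S G (Suc i) = answers S G i @ [S (answers S G i) \<inter> G]"

text \<open>Rounds are numbered from 0.\<close>

definition queries :: "strategy \<Rightarrow> edge_set \<Rightarrow> nat \<Rightarrow> edge_set" where
  "queries S G i = S (answers S G i)"

definition found_graph :: "strategy \<Rightarrow> edge_set \<Rightarrow> nat \<Rightarrow> edge_set" where
  "found_graph S G l = (\<Union>i<l. queries S G i \<inter> G)"

text \<open>An algorithm consists of one strategy \<open>A n\<close> for each number \<open>n\<close> of vertices; the function
  \<open>h\<close> is the \<open>o(log n)\<close> error term.\<close>

definition clique_algorithm :: "real \<Rightarrow> nat \<Rightarrow> real \<Rightarrow> (nat \<Rightarrow> strategy) \<Rightarrow> bool" where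
  "clique_algorithm \<delta> l \<alpha> A \<longleftrightarrow>
     (\<forall>n. \<forall>G \<subseteq> nsets {..<n} 2. \<forall>i<l.
        queries (A n) G i \<subseteq> nsets {..<n} 2 \<and>
        real (card (queries (A n) G i)) \<le> real n powr \<delta>) \<and>
     (\<exists>h :: nat \<Rightarrow> real. h \<in> o(\<lambda>n. log 2 (real n)) \<and>
        (\<forall>\<^sub>F n in sequentially.
           measure_pmf.prob (random_graph n (1/2))
             {G. \<exists>C \<subseteq> {..<n}. clique C (found_graph (A n) G l) \<and>
                   real (card C) \<ge> \<alpha> * log 2 (real n) - h n} \<ge> 1/2))"

definition alpha_star :: "real \<Rightarrow> nat \<Rightarrow> real" where
  "alpha_star \<delta> l = Sup {\<alpha>. \<alpha> \<le> 2 \<and> (\<exists>A. clique_algorithm \<delta> l \<alpha> A)}"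

text \<open>The supremum is taken over a nonempty set that is bounded above, so it is a genuine one.\<close>

lemma alpha_star_set_nonempty:
  "{\<alpha>. \<alpha> \<le> 2 \<and> (\<exists>A. clique_algorithm \<delta> l \<alpha> A)} \<noteq> {}"
proof -
  have "clique_algorithm \<delta> l 0 (\<lambda>_ _. {})"
    unfolding clique_algorithm_def
  proof (intro conjI exI[of _ "\<lambda>_. 0"])
    have "{G. \<exists>C \<subseteq> {..<n}. clique C (found_graph (\<lambda>_. {}) G l) \<and>
            real (card C) \<ge> 0 * log 2 (real n) - 0} = UNIV" for n
      by (auto intro!: exI[of _ "{}"] simp: clique_def)
    then show "\<forall>\<^sub>F n in sequentially. measure_pmf.prob (random_graph n (1/2))
             {G. \<exists>C \<subseteq> {..<n}. clique C (found_graph (\<lambda>_. {}) G l) \<and>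
                   real (card C) \<ge> 0 * log 2 (real n) - 0} \<ge> 1/2"
      by simp
  qed (auto simp: queries_def)
  then show ?thesis by (auto intro!: exI[of _ 0])
qed

lemma alpha_star_set_bdd_above:
  "bdd_above {\<alpha>. \<alpha> \<le> 2 \<and> (\<exists>A. clique_algorithm \<delta> l \<alpha> A)}"
  by (auto intro: bdd_aboveI[of _ 2])

end

theory Submission
  imports Defs "HOL-Real_Asymp.Real_Asymp"
begin

text \<open>Let \<open>L = log 2 n\<close> and let \<open>K\<close> be a clique with \<open>k \<approx> \<alpha> * L\<close> vertices that was found, where
  \<open>\<alpha> > 1 + sqrt ((\<delta> - 1) * (3 - \<delta>))\<close>. The pairs queried in the first round form a fixed graph \<open>F\<close>.
  The cost of \<open>K\<close> bounds the number of bits, in units of \<open>L\<close>, needed to describe \<open>K\<close> with the help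
  of \<open>F\<close>: a vertex of large degree \<open>n powr d\<close> costs \<open>\<delta> - d\<close>, a vertex of small degree with a
  small-degree neighbour in \<open>K\<close> costs \<open>\<delta> / 2\<close>, and any other vertex costs as much as choosing a
  neighbour of an already described vertex. A union bound excludes cliques whose cost times \<open>L\<close> is
  well below \<open>k\<^sup>2 / 2\<close>. For an expensive clique, averaging over a degree threshold yields disjoint
  \<open>P, R \<subseteq> K\<close> such that the neighbours of \<open>R\<close> in \<open>F\<close> and \<open>K\<close> lie in \<open>P\<close> and \<open>card R - card P\<close> is
  large (a replacement for the half-integral Koenig duality). Hence in \<open>S = K - P\<close> every pair that is
  not inside \<open>Q = S - R\<close> was queried in the second round only. These pairs contain a near-perfect
  matching of \<open>S\<close>, so after the first round there are at most \<open>n powr (\<delta> * card S / 2 + 1)\<close>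
  candidates for \<open>S\<close>, and a second union bound, conditional on the first answers, excludes them.\<close>

section \<open>Union bound for revealed random graphs\<close>

lemma random_graph_half: "random_graph n (1/2) = pmf_of_set (Pow (nsets {..<n} 2))"
  unfolding random_graph_def by (rule pmf_of_set_Pow_conv_bernoulli) (simp add: finite_imp_finite_nsets)

text \<open>Given the answers \<open>H = F \<inter> G\<close>, the pairs outside \<open>F\<close>
  remain uniformly random, so a fixed \<open>X\<close> survives with probability at most
  \<open>1 / 2 ^ c\<close>. Hence the family \<open>\<P>\<close> may depend on the answers in
  \<open>F\<close>; \<open>F = {}\<close> gives the ordinary union bound.\<close>

lemma prob_contains_revealed_le:
  fixes E F :: "'a set" and \<P> :: "'a set \<Rightarrow> 'a set set"
  assumes E: "finite E" and F: "F \<subseteq> E"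
    and sub: "\<And>H X. H \<subseteq> F \<Longrightarrow> X \<in> \<P> H \<Longrightarrow> X \<subseteq> E - F"
    and cX: "\<And>H X. H \<subseteq> F \<Longrightarrow> X \<in> \<P> H \<Longrightarrow> c \<le> card X"
    and N: "\<And>H. H \<subseteq> F \<Longrightarrow> real (card (\<P> H)) \<le> N"
  shows "measure_pmf.prob (pmf_of_set (Pow E)) {G. \<exists>X\<in>\<P> (F \<inter> G). X \<subseteq> G} \<le> N / 2 ^ c"
proof -
  let ?B = "{G \<in> Pow E. \<exists>X\<in>\<P> (F \<inter> G). X \<subseteq> G}"
  let ?S = "\<lambda>H X. {G \<in> Pow E. F \<inter> G = H \<and> X \<subseteq> G}"
  have finF: "finite F" using E F finite_subset by blast
  have finP: "finite (\<P> H)" if "H \<subseteq> F" for H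
    by (rule finite_subset[of _ "Pow E"]) (use sub[OF that] E in auto)
  have one: "real (card (?S H X)) \<le> 2 ^ card E / 2 ^ card F / 2 ^ c"
    if H: "H \<subseteq> F" and X: "X \<in> \<P> H" for H X
  proof -
    have XE: "X \<subseteq> E - F" using sub[OF H X] .
    \<comment> \<open>Once \<open>H\<close> and \<open>X\<close> are fixed, \<open>G\<close> is
      recovered from its part outside \<open>F\<close> and \<open>X\<close>.\<close>
    have "inj_on (\<lambda>G. G - F - X) (?S H X)"
      by (rule inj_onI) blast
    moreover have "(\<lambda>G. G - F - X) ` ?S H X \<subseteq> Pow (E - F - X)" by blast
    ultimately have "card (?S H X) \<le> card (Pow (E - F - X))"
      using E by (intro card_inj_on_le) auto
    also have "\<dots> = 2 ^ (card E - card F - card X)"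
      using E F XE finF finite_subset[OF XE] by (simp add: card_Pow card_Diff_subset)
    finally have "real (card (?S H X)) \<le> real (2 ^ (card E - card F - card X))"
      by (rule of_nat_mono)
    also have "\<dots> = 2 ^ (card E - card F - card X)" by simp
    also have "\<dots> \<le> 2 ^ (card E - card F - c)"
      using cX[OF H X] by (intro power_increasing) auto
    also have "\<dots> = 2 ^ card E / 2 ^ card F / 2 ^ c"
    proof -
      have "card F + card X \<le> card E"
        using card_mono[OF E, of "F \<union> X"] XE F finF finite_subset[OF XE] E
        by (subst card_Un_disjoint[symmetric]) auto
      then show ?thesis using cX[OF H X] by (simp add: power_diff power_add)
    qed
    finally show ?thesis .
  qed
  have "card ?B \<le> card (\<Union>H\<in>Pow F. \<Union>X\<in>\<P> H. ?S H X)"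
    using E finF finP by (intro card_mono) (auto intro!: finite_UN_I)
  also have "\<dots> \<le> (\<Sum>H\<in>Pow F. card (\<Union>X\<in>\<P> H. ?S H X))"
    using finF by (intro card_UN_le) auto
  also have "\<dots> \<le> (\<Sum>H\<in>Pow F. \<Sum>X\<in>\<P> H. card (?S H X))"
    using finP by (intro sum_mono card_UN_le) auto
  finally have "real (card ?B) \<le> real (\<Sum>H\<in>Pow F. \<Sum>X\<in>\<P> H. card (?S H X))"
    by (rule of_nat_mono)
  also have "\<dots> = (\<Sum>H\<in>Pow F. \<Sum>X\<in>\<P> H. real (card (?S H X)))"
    by (simp only: of_nat_sum)
  also have "\<dots> \<le> (\<Sum>H\<in>Pow F. \<Sum>X\<in>\<P> H. 2 ^ card E / 2 ^ card F / 2 ^ c)"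
    by (intro sum_mono one) auto
  also have "\<dots> = (\<Sum>H\<in>Pow F. card (\<P> H) * (2 ^ card E / 2 ^ card F / 2 ^ c))"
    by simp
  also have "\<dots> \<le> (\<Sum>H\<in>Pow F. N * (2 ^ card E / 2 ^ card F / 2 ^ c))"
    by (intro sum_mono mult_right_mono N) auto
  also have "\<dots> = 2 ^ card E * (N / 2 ^ c)"
    using finF by (simp add: card_Pow)
  finally have "real (card ?B) / 2 ^ card E \<le> N / 2 ^ c"
    by (simp add: pos_divide_le_eq mult.commute)
  moreover have "measure_pmf.prob (pmf_of_set (Pow E)) {G. \<exists>X\<in>\<P> (F \<inter> G). X \<subseteq> G} = card ?B / 2 ^ card E"
    using E by (subst measure_pmf_of_set) (auto simp: card_Pow Int_def intro!: arg_cong[where f=card])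
  ultimately show ?thesis by simp
qed

text \<open>Layer-cake argument: \<open>f x - a\<close> is the length of the set of thresholds
  \<open>t\<close> in \<open>{a..b}\<close> with \<open>t < f x\<close>, so the difference of sums
  integrates a difference of counts, which must exceed \<open>Y\<close> somewhere.\<close>

lemma exists_threshold_card_diff:
  fixes f :: "'a \<Rightarrow> real" and g :: "'b \<Rightarrow> real"
  assumes "finite A" "finite B" and ab: "a < b"
    and f: "\<And>x. x \<in> A \<Longrightarrow> f x \<in> {a..b}" and g: "\<And>x. x \<in> B \<Longrightarrow> g x \<in> {a..b}"
    and le: "(b - a) * Y < (\<Sum>x\<in>A. f x - a) - (\<Sum>x\<in>B. g x - a)"
  obtains t where "t \<in> {a..b}" "Y \<le> real (card {x\<in>A. t < f x}) - real (card {x\<in>B. t < g x})"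
proof -
  have ind: "((\<lambda>t. if t < c then 1 else 0) has_integral (c - a)) {a..b}" if "c \<in> {a..b}" for c :: real
  proof -
    have "((\<lambda>t. 1::real) has_integral (c - a)) {a..c}"
      using has_integral_const_real[of "1::real" a c] that by simp
    then have "((\<lambda>t. if t \<in> {a..c} then 1 else 0::real) has_integral (c - a)) {a..b}"
      using that by (subst has_integral_restrict) auto
    \<comment> \<open>The indicators of \<open>t < c\<close> and of \<open>{a..c}\<close> differ on
      the interval only at the null set \<open>{c}\<close>.\<close>
    then show ?thesis
      by (rule has_integral_spike[rotated 2, where S="{c}"]) auto
  qed
  have "((\<lambda>t. (\<Sum>x\<in>A. if t < f x then 1 else 0) - (\<Sum>x\<in>B. if t < g x then 1 else 0))
      has_integral ((\<Sum>x\<in>A. f x - a) - (\<Sum>x\<in>B. g x - a))) {a..b}"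
    using assms by (intro has_integral_diff has_integral_sum ind) auto
  moreover have "((\<lambda>t. Y) has_integral ((b - a) * Y)) {a..b}"
    using has_integral_const_real[of Y a b] ab by simp
  ultimately have "\<not> (\<forall>t\<in>{a..b}. (\<Sum>x\<in>A. if t < f x then 1 else 0) - (\<Sum>x\<in>B. if t < g x then 1 else 0) \<le> Y)"
    using has_integral_le le by (meson not_le)
  then obtain t where "t \<in> {a..b}"
    "Y < (\<Sum>x\<in>A. if t < f x then 1 else 0) - (\<Sum>x\<in>B. if t < g x then 1 else 0)"
    by (auto simp: not_le)
  moreover have "(\<Sum>x\<in>A. if t < f x then 1 else (0::real)) = card {x\<in>A. t < f x}"
    "(\<Sum>x\<in>B. if t < g x then 1 else (0::real)) = card {x\<in>B. t < g x}"
    using assms(1,2) by (simp_all add: sum.If_cases Int_def)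
  ultimately show ?thesis using that[of t] by auto
qed

section \<open>Counting vertex sets by weighted growth\<close>

definition vdeg :: "edge_set \<Rightarrow> nat \<Rightarrow> nat" where
  "vdeg F u = card {v. {u, v} \<in> F}"

lemma neighbours_subset: "(F :: edge_set) \<subseteq> nsets {..<n} 2 \<Longrightarrow> {v. {u, v} \<in> F} \<subseteq> {..<n}"
  by (auto simp: nsets_def)

lemma finite_neighbours: "(F :: edge_set) \<subseteq> nsets {..<n} 2 \<Longrightarrow> finite {v. {u, v} \<in> F}"
  by (rule finite_subset[OF neighbours_subset]) auto

lemma vdeg_le: "F \<subseteq> nsets {..<n} 2 \<Longrightarrow> vdeg F u \<le> n"
  using card_mono[OF _ neighbours_subset, of n F u] by (simp add: vdeg_def)

lemma vdeg_pos: "F \<subseteq> nsets {..<n} 2 \<Longrightarrow> {u, v} \<in> F \<Longrightarrow> 0 < vdeg F u"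
  using finite_neighbours[of F n u] by (auto simp: vdeg_def card_gt_0_iff)

text \<open>Handshake count over ordered pairs: an edge \<open>{a, b}\<close> comes only from
  \<open>(a, b)\<close> and \<open>(b, a)\<close>.\<close>

lemma sum_vdeg_le:
  assumes F: "F \<subseteq> nsets {..<n} 2"
  shows "(\<Sum>u<n. vdeg F u) \<le> 2 * card F"
proof -
  have finF: "finite F" using F finite_imp_finite_nsets finite_subset by blast
  have "(\<Sum>u<n. vdeg F u) = card (SIGMA u:{..<n}. {v. {u, v} \<in> F})"
    using finite_neighbours[OF F] by (simp add: vdeg_def)
  also have "\<dots> \<le> card (\<Union>e\<in>F. {p. {fst p, snd p} = e})"
  proof (rule card_mono)
    have "(\<Union>e\<in>F. {p. {fst p, snd p} = e}) \<subseteq> {..<n} \<times> {..<n}"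
      using F by (auto simp: nsets_def)
    then show "finite (\<Union>e\<in>F. {p. {fst p, snd p} = e})" by (rule finite_subset) simp
  qed auto
  also have "\<dots> \<le> (\<Sum>e\<in>F. card {p. {fst p, snd p} = e})"
    by (rule card_UN_le[OF finF])
  also have "\<dots> \<le> (\<Sum>e\<in>F. 2)"
  proof (rule sum_mono)
    fix e assume "e \<in> F"
    then obtain a b where "e = {a, b}"
      using F by (auto simp: nsets_def card_2_iff)
    then have "{p. {fst p, snd p} = e} \<subseteq> {(a, b), (b, a)}"
      by (auto simp: doubleton_eq_iff)
    then have "card {p. {fst p, snd p} = e} \<le> card {(a, b), (b, a)}"
      by (intro card_mono) auto
    also have "\<dots> \<le> 2" using card_length[of "[(a, b), (b, a)]"] by simp
    finally show "card {p. {fst p, snd p} = e} \<le> 2" .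
  qed
  finally show ?thesis by simp
qed

text \<open>The transition weights of a random growth of vertex sets: keep the set, add a uniform vertex,
  add a vertex with probability proportional to its degree, add a random neighbour of a random
  vertex of the set, or add both ends of a random edge. Here \<open>m\<close> is an upper bound on the number
  of edges. The total weight of the sets reached after \<open>j\<close> steps is at most \<open>5 ^ j\<close>, so few sets
  can have a large weight.\<close>

definition step_weight :: "edge_set \<Rightarrow> nat \<Rightarrow> real \<Rightarrow> nat set \<Rightarrow> nat set \<Rightarrow> real" where
  "step_weight F n m B C =
     (if C = B then 1 else 0) +
     (\<Sum>v<n. if C = insert v B then 1 / n else 0) +
     (\<Sum>v<n. if C = insert v B then vdeg F v / (2 * m) else 0) +
     (\<Sum>u\<in>B. \<Sum>v\<in>{v. {u, v} \<in> F}. if C = insert v B then 1 / (vdeg F u * card B) else 0) +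
     (\<Sum>e\<in>F. if C = B \<union> e then 1 / m else 0)"

primrec growth_weight :: "edge_set \<Rightarrow> nat \<Rightarrow> real \<Rightarrow> nat \<Rightarrow> nat set \<Rightarrow> real" where
  "growth_weight F n m 0 C = (if C = {} then 1 else 0)"
| "growth_weight F n m (Suc j) C =
     (\<Sum>B\<in>Pow {..<n}. growth_weight F n m j B * step_weight F n m B C)"

section \<open>Total mass of the growth weights and lower bounds along single paths\<close>

context
  fixes F :: edge_set and n :: nat and m :: real
  assumes F: "F \<subseteq> nsets {..<n} 2" and m: "0 < m" "real (card F) \<le> m" and n: "0 < n"
begin

private lemma finF: "finite F"
  using F finite_imp_finite_nsets finite_subset by blast

lemma step_weight_nonneg: "0 \<le> step_weight F n m B C"
  unfolding step_weight_def using m by (intro add_nonneg_nonneg sum_nonneg) auto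

lemma growth_weight_nonneg: "0 \<le> growth_weight F n m j C"
  by (induction j arbitrary: C) (auto intro!: sum_nonneg mult_nonneg_nonneg step_weight_nonneg)

text \<open>Each of the five summands has total mass at most 1: handshaking bounds the degree term,
  the neighbour term is a uniform choice in \<open>B\<close> followed by a uniform neighbour, and
  \<open>card F \<le> m\<close> bounds the edge term.\<close>

lemma sum_step_weight_le:
  assumes "finite B"
  shows "(\<Sum>C\<in>Pow {..<n}. step_weight F n m B C) \<le> 5"
proof -
  let ?U = "Pow {..<n}"
  have delta: "(\<Sum>C\<in>?U. if C = X then c else 0) \<le> c" if "0 \<le> c" for X and c :: real
    using that by (simp add: sum.delta)
  \<comment> \<open>Every option \<open>x\<close> leads to the single set \<open>X x\<close>, so
    after exchanging the sums it contributes \<open>c x\<close> at most once.\<close>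
  have swap: "(\<Sum>C\<in>?U. \<Sum>x\<in>A. if C = X x then c x else 0) \<le> (\<Sum>x\<in>A. c x)"
    if "\<And>x. x \<in> A \<Longrightarrow> 0 \<le> c x" for A and X :: "'x \<Rightarrow> nat set" and c :: "'x \<Rightarrow> real"
    by (subst sum.swap) (intro sum_mono delta that)
  have "(\<Sum>C\<in>?U. if C = B then 1 else 0) \<le> (1::real)" by (rule delta) simp
  moreover have "(\<Sum>C\<in>?U. \<Sum>v<n. if C = insert v B then 1 / n else 0) \<le> (1::real)"
    using swap[of "{..<n}" "\<lambda>_. 1 / n"] n by simp
  moreover have "(\<Sum>C\<in>?U. \<Sum>v<n. if C = insert v B then vdeg F v / (2 * m) else 0) \<le> (1::real)"
  proof -
    have "(\<Sum>C\<in>?U. \<Sum>v<n. if C = insert v B then vdeg F v / (2 * m) else 0) \<le>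
        (\<Sum>v<n. vdeg F v / (2 * m))"
      using m by (intro swap) auto
    also have "\<dots> = real (\<Sum>v<n. vdeg F v) / (2 * m)" by (simp add: sum_divide_distrib)
    also have "\<dots> \<le> 1"
    proof -
      have "real (\<Sum>v<n. vdeg F v) \<le> 2 * m"
        using sum_vdeg_le[OF F] m by linarith
      then show ?thesis using m by simp
    qed
    finally show ?thesis .
  qed
  moreover have "(\<Sum>C\<in>?U. \<Sum>u\<in>B. \<Sum>v\<in>{v. {u, v} \<in> F}.
      if C = insert v B then 1 / (vdeg F u * card B) else 0) \<le> (1::real)"
  proof -
    have "(\<Sum>C\<in>?U. \<Sum>u\<in>B. \<Sum>v\<in>{v. {u, v} \<in> F}.
      if C = insert v B then 1 / (vdeg F u * card B) else 0) \<le>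
      (\<Sum>u\<in>B. \<Sum>v\<in>{v. {u, v} \<in> F}. 1 / (vdeg F u * card B))"
      by (subst sum.swap) (intro sum_mono swap, auto)
    also have "\<dots> \<le> (\<Sum>u\<in>B. 1 / card B)"
      by (intro sum_mono) (auto simp: vdeg_def divide_simps)
    also have "\<dots> \<le> 1" by (cases "B = {}") (use assms in auto)
    finally show ?thesis .
  qed
  moreover have "(\<Sum>C\<in>?U. \<Sum>e\<in>F. if C = B \<union> e then 1 / m else 0) \<le> 1"
  proof -
    have "(\<Sum>C\<in>?U. \<Sum>e\<in>F. if C = B \<union> e then 1 / m else 0) \<le> (\<Sum>e\<in>F. 1 / m)"
      using m by (intro swap) auto
    also have "\<dots> \<le> 1" using m by simp
    finally show ?thesis .
  qed
  ultimately show ?thesis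
    unfolding step_weight_def sum.distrib by linarith
qed

lemma sum_growth_weight_le: "(\<Sum>C\<in>Pow {..<n}. growth_weight F n m j C) \<le> 5 ^ j"
proof (induction j)
  case 0
  show ?case by (simp add: sum.delta)
next
  case (Suc j)
  have "(\<Sum>C\<in>Pow {..<n}. growth_weight F n m (Suc j) C) =
    (\<Sum>B\<in>Pow {..<n}. growth_weight F n m j B * (\<Sum>C\<in>Pow {..<n}. step_weight F n m B C))"
    by (simp only: growth_weight.simps sum_distrib_left) (rule sum.swap)
  also have "\<dots> \<le> (\<Sum>B\<in>Pow {..<n}. growth_weight F n m j B * 5)"
    by (intro sum_mono mult_left_mono growth_weight_nonneg sum_step_weight_le)
      (auto intro: finite_subset)
  also have "\<dots> \<le> 5 ^ Suc j"
    using Suc.IH by (simp flip: sum_distrib_right)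
  finally show ?case .
qed

text \<open>The summands of the recursion are nonnegative, so a single way of reaching
  \<open>C\<close> already bounds its weight from below. Later lower bounds multiply such steps
  along one path.\<close>

lemma growth_weight_step:
  assumes "B \<subseteq> {..<n}" "w \<le> step_weight F n m B C"
  shows "growth_weight F n m j B * w \<le> growth_weight F n m (Suc j) C"
proof -
  have "growth_weight F n m j B * w \<le> growth_weight F n m j B * step_weight F n m B C"
    using assms growth_weight_nonneg by (intro mult_left_mono)
  also have "\<dots> \<le> growth_weight F n m (Suc j) C"
    unfolding growth_weight.simps using assms
    by (intro member_le_sum) (auto intro: mult_nonneg_nonneg growth_weight_nonneg step_weight_nonneg)
  finally show ?thesis .
qed

private lemma sum_if_ge:
  fixes c :: "'x \<Rightarrow> real"
  assumes "finite A" "x \<in> A" "\<And>y. y \<in> A \<Longrightarrow> 0 \<le> c y"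
  shows "c x \<le> (\<Sum>y\<in>A. if X x = X y then c y else 0)"
  using member_le_sum[of x A "\<lambda>y. if X x = X y then c y else 0"] assms by auto

lemma step_weight_ge:
  assumes B: "B \<subseteq> {..<n}"
  shows "1 \<le> step_weight F n m B B"
    and "v < n \<Longrightarrow> 1 / n \<le> step_weight F n m B (insert v B)"
    and "v < n \<Longrightarrow> vdeg F v / (2 * m) \<le> step_weight F n m B (insert v B)"
    and "u \<in> B \<Longrightarrow> {u, v} \<in> F \<Longrightarrow> 1 / (vdeg F u * card B) \<le> step_weight F n m B (insert v B)"
    and "e \<in> F \<Longrightarrow> 1 / m \<le> step_weight F n m B (B \<union> e)"
proof -
  have finB: "finite B" using B finite_subset by blast
  define s1 where "s1 C = (if C = B then 1 else 0::real)" for C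
  define s2 where "s2 C = (\<Sum>v<n. if C = insert v B then 1 / n else 0::real)" for C
  define s3 where "s3 C = (\<Sum>v<n. if C = insert v B then vdeg F v / (2 * m) else 0)" for C
  define s4 where "s4 C = (\<Sum>u\<in>B. \<Sum>v\<in>{v. {u, v} \<in> F}. if C = insert v B then 1 / (vdeg F u * card B) else 0::real)" for C
  define s5 where "s5 C = (\<Sum>e\<in>F. if C = B \<union> e then 1 / m else 0)" for C
  have s: "step_weight F n m B C = s1 C + s2 C + s3 C + s4 C + s5 C" for C
    by (simp add: step_weight_def s1_def s2_def s3_def s4_def s5_def)
  have nn: "0 \<le> s1 C" "0 \<le> s2 C" "0 \<le> s3 C" "0 \<le> s4 C" "0 \<le> s5 C" for C
    unfolding s1_def s2_def s3_def s4_def s5_def using m by (auto intro!: sum_nonneg)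
  show "1 \<le> step_weight F n m B B"
    using nn[of B] by (simp add: s s1_def)
  show "1 / n \<le> step_weight F n m B (insert v B)" if "v < n"
  proof -
    have "1 / n \<le> s2 (insert v B)"
      unfolding s2_def using that by (intro sum_if_ge[where c="\<lambda>_. 1 / n" and X="\<lambda>v. insert v B"]) auto
    then show ?thesis using nn[of "insert v B"] by (simp add: s)
  qed
  show "vdeg F v / (2 * m) \<le> step_weight F n m B (insert v B)" if "v < n"
  proof -
    have "vdeg F v / (2 * m) \<le> s3 (insert v B)"
      unfolding s3_def using that m
      by (intro sum_if_ge[where c="\<lambda>v. vdeg F v / (2 * m)" and X="\<lambda>v. insert v B"]) auto
    then show ?thesis using nn[of "insert v B"] by (simp add: s)
  qed
  show "1 / (vdeg F u * card B) \<le> step_weight F n m B (insert v B)" if "u \<in> B" "{u, v} \<in> F"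
  proof -
    have "1 / (vdeg F u * card B) \<le>
        (\<Sum>v'\<in>{v. {u, v} \<in> F}. if insert v B = insert v' B then 1 / (vdeg F u * card B) else 0)"
      using that finite_neighbours[OF F]
      by (intro sum_if_ge[where c="\<lambda>_. 1 / (vdeg F u * card B)" and X="\<lambda>v. insert v B"]) auto
    also have "\<dots> \<le> s4 (insert v B)"
      unfolding s4_def using that finB
      by (intro member_le_sum[where f="\<lambda>u. \<Sum>v'\<in>{v. {u, v} \<in> F}.
          if insert v B = insert v' B then 1 / (vdeg F u * card B) else 0"]) (auto intro: sum_nonneg)
    finally show ?thesis using nn[of "insert v B"] by (simp add: s)
  qed
  show "1 / m \<le> step_weight F n m B (B \<union> e)" if "e \<in> F"
  proof -
    have "1 / m \<le> s5 (B \<union> e)"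
      unfolding s5_def using that m finF
      by (intro sum_if_ge[where c="\<lambda>_. 1 / m" and X="\<lambda>e. B \<union> e"]) auto
    then show ?thesis using nn[of "B \<union> e"] by (simp add: s)
  qed
qed

text \<open>This is the purpose of the idle move: it makes paths of different lengths comparable,
  which is needed once an edge step adds two vertices at a time.\<close>

lemma growth_weight_mono:
  assumes C: "C \<subseteq> {..<n}" and "i \<le> j"
  shows "growth_weight F n m i C \<le> growth_weight F n m j C"
  using \<open>i \<le> j\<close>
proof (induction rule: dec_induct)
  case (step l)
  show ?case
    using step.IH growth_weight_step[OF C step_weight_ge(1)[OF C], of l] by simp
qed simp

lemma growth_weight_by_degree:
  assumes "finite H" "H \<subseteq> {..<n}"
  shows "(\<Prod>u\<in>H. vdeg F u / (2 * m)) \<le> growth_weight F n m (card H) H"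
  using assms
proof (induction H rule: finite_induct)
  case (insert v H)
  have "(\<Prod>u\<in>insert v H. vdeg F u / (2 * m)) \<le> growth_weight F n m (card H) H * (vdeg F v / (2 * m))"
    unfolding prod.insert[OF insert.hyps] mult.commute[of "vdeg F v / (2 * m)"]
    using insert m by (intro mult_right_mono) auto
  also have "\<dots> \<le> growth_weight F n m (Suc (card H)) (insert v H)"
    using insert by (intro growth_weight_step step_weight_ge) auto
  finally show ?case using insert by simp
qed simp

text \<open>A missing \<open>v\<close> has a neighbour \<open>u\<close> in \<open>T\<close>. If
  \<open>u\<close> is already present, choosing \<open>u\<close> and then \<open>v\<close> has
  weight at least \<open>1 / (k * b)\<close>. Otherwise one edge step adds both, and
  \<open>m \<le> b\<^sup>2\<close> lets its weight \<open>1 / m\<close> pay for two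
  vertices.\<close>

lemma growth_weight_low_degree:
  assumes "T \<subseteq> {..<n}" "B \<subseteq> {..<n}"
    and nb: "\<And>v. v \<in> T \<Longrightarrow> \<exists>u\<in>T. {u, v} \<in> F"
    and low: "\<And>u. u \<in> T \<Longrightarrow> real (vdeg F u) \<le> b"
    and k: "card (B \<union> T) \<le> k" and b: "0 < b" and mb: "m \<le> b\<^sup>2"
  shows "growth_weight F n m j B * (1 / (k * b)) ^ card (T - B) \<le> growth_weight F n m (j + card (T - B)) (B \<union> T)"
  using assms(2) k
proof (induction "card (T - B)" arbitrary: B j rule: less_induct)
  case (less B)
  have finT: "finite T" and finB: "finite B" using assms(1) less.prems(1) finite_subset by blast+
  show ?case
  proof (cases "T \<subseteq> B")
    case True
    then show ?thesis by (simp add: Un_absorb2 Diff_eq_empty_iff[THEN iffD2])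
  next
    case False
    then obtain v where v: "v \<in> T" "v \<notin> B" by blast
    obtain u where u: "u \<in> T" "{u, v} \<in> F" using nb[OF v(1)] by blast
    have "card (B \<union> T) > 0" using v finT finB by (auto simp: card_gt_0_iff)
    then have k0: "1 \<le> k" using less.prems by linarith
    show ?thesis
    proof (cases "u \<in> B")
      case True
      have c: "card (T - B) = Suc (card (T - insert v B))"
        using v finT by (metis Diff_insert card_Suc_Diff1 DiffI finite_Diff)
      have "card B \<le> k" using card_mono[of "B \<union> T" B] finT finB less.prems by simp
      have "0 < card B" using True finB by (auto simp: card_gt_0_iff)
      have "real (vdeg F u) * card B \<le> b * k"
        using low[OF u(1)] \<open>card B \<le> k\<close> b by (intro mult_mono) auto
      then have "1 / (k * b) \<le> 1 / (vdeg F u * card B)"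
        using vdeg_pos[OF F u(2)] \<open>0 < card B\<close> k0 b
        by (intro divide_left_mono mult_pos_pos) (auto simp: mult.commute)
      then have "growth_weight F n m j B * (1 / (k * b)) \<le> growth_weight F n m (Suc j) (insert v B)"
        using less.prems True u by (intro growth_weight_step order_trans[OF _ step_weight_ge(4)]) auto
      then have "growth_weight F n m j B * (1 / (k * b)) ^ card (T - B) \<le>
         growth_weight F n m (Suc j) (insert v B) * (1 / (k * b)) ^ card (T - insert v B)"
        unfolding c power_Suc mult.assoc[symmetric] using b by (intro mult_right_mono) auto
      also have "\<dots> \<le> growth_weight F n m (Suc j + card (T - insert v B)) (insert v B \<union> T)"
      proof (rule less.hyps)
        show "card (insert v B \<union> T) \<le> k" using less.prems v by (simp add: insert_absorb)
      qed (use less.prems v assms(1) c in auto)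
      also have "insert v B \<union> T = B \<union> T" using v by auto
      finally show ?thesis using c by simp
    next
      case False
      have "u \<noteq> v" using u F by (auto simp: nsets_def)
      have c: "card (T - B) = Suc (Suc (card (T - (B \<union> {u, v}))))"
      proof -
        have eq: "T - B = insert u (insert v (T - (B \<union> {u, v})))" using u v False by auto
        show ?thesis by (subst eq) (use finT \<open>u \<noteq> v\<close> in simp)
      qed
      have "1 / (k * b) * (1 / (k * b)) = 1 / (k\<^sup>2 * b\<^sup>2)" by (simp add: power2_eq_square)
      also have "\<dots> \<le> 1 / m"
      proof -
        have "1 * b\<^sup>2 \<le> (real k)\<^sup>2 * b\<^sup>2" using k0 by (intro mult_right_mono) auto
        then have "m \<le> (real k)\<^sup>2 * b\<^sup>2" using mb by simp
        then show ?thesis using m b k0 by (intro divide_left_mono mult_pos_pos) auto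
      qed
      finally have "1 / (k * b) * (1 / (k * b)) \<le> 1 / m" .
      then have "growth_weight F n m j B * (1 / (k * b) * (1 / (k * b))) \<le> growth_weight F n m (Suc j) (B \<union> {u, v})"
        using less.prems u by (intro growth_weight_step order_trans[OF _ step_weight_ge(5)]) auto
      then have "growth_weight F n m j B * (1 / (k * b)) ^ card (T - B) \<le>
         growth_weight F n m (Suc j) (B \<union> {u, v}) * (1 / (k * b)) ^ card (T - (B \<union> {u, v}))"
        unfolding c power_Suc mult.assoc[symmetric] using b by (intro mult_right_mono) (auto simp: mult.assoc)
      also have "\<dots> \<le> growth_weight F n m (Suc j + card (T - (B \<union> {u, v}))) (B \<union> {u, v} \<union> T)"
      proof (rule less.hyps)
        show "card (B \<union> {u, v} \<union> T) \<le> k" using less.prems u v by (simp add: insert_absorb)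
      qed (use less.prems u v assms(1) c in auto)
      also have "B \<union> {u, v} \<union> T = B \<union> T" using u v by auto
      also have "growth_weight F n m (Suc j + card (T - (B \<union> {u, v}))) (B \<union> T) \<le>
          growth_weight F n m (j + card (T - B)) (B \<union> T)"
        using less.prems assms(1) c by (intro growth_weight_mono) auto
      finally show ?thesis .
    qed
  qed
qed

text \<open>\<open>D r\<close> bounds the number of candidates for \<open>r\<close>: all
  \<open>n\<close> vertices, or the neighbours of some \<open>u\<close>; the factor \<open>k\<close>
  pays for the choice of \<open>u\<close>. As \<open>u\<close> lies in the starting set
  \<open>B\<close>, the vertices of \<open>R\<close> can be added in any order.\<close>

lemma growth_weight_neighbours:
  assumes "finite R" "R \<subseteq> {..<n}" "B \<subseteq> {..<n}" "R \<inter> B = {}"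
    and D: "\<And>r. r \<in> R \<Longrightarrow> 0 < D r \<and> (real n \<le> D r \<or> (\<exists>u\<in>B. {u, r} \<in> F \<and> real (vdeg F u) \<le> D r))"
    and k: "card (B \<union> R) \<le> k"
  shows "growth_weight F n m j B * (\<Prod>r\<in>R. 1 / (k * D r)) \<le> growth_weight F n m (j + card R) (B \<union> R)"
  using assms(1,2,4) D k
proof (induction R rule: finite_induct)
  case empty
  then show ?case by simp
next
  case (insert v R)
  have fin: "finite B" using assms(3) finite_subset by blast
  let ?C = "B \<union> R"
  have Cn: "?C \<subseteq> {..<n}" using insert.prems assms(3) by auto
  have cC: "card ?C < k"
  proof -
    have "card (insert v ?C) = Suc (card ?C)" using insert fin by (intro card_insert_disjoint) auto
    then show ?thesis using insert.prems(4) by simp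
  qed
  have Dv: "0 < D v" using insert.prems by auto
  have "1 / (k * D v) \<le> step_weight F n m ?C (insert v ?C)"
  proof (cases "real n \<le> D v")
    case True
    have "1 * real n \<le> k * D v" using True cC by (intro mult_mono) auto
    then have "1 / (k * D v) \<le> 1 / n" using n Dv cC by (intro divide_left_mono mult_pos_pos) auto
    also have "\<dots> \<le> step_weight F n m ?C (insert v ?C)"
      using insert.prems Cn by (intro step_weight_ge) auto
    finally show ?thesis .
  next
    case False
    then obtain u where u: "u \<in> B" "{u, v} \<in> F" "real (vdeg F u) \<le> D v"
      using insert.prems(3)[of v] by auto
    have "0 < card ?C" using u insert fin by (auto simp: card_gt_0_iff)
    have "real (vdeg F u) * card ?C \<le> D v * k"
      using u(3) cC Dv by (intro mult_mono) auto
    then have "1 / (k * D v) \<le> 1 / (vdeg F u * card ?C)"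
      using vdeg_pos[OF F u(2)] \<open>0 < card ?C\<close> cC Dv
      by (intro divide_left_mono mult_pos_pos) (auto simp: mult.commute)
    also have "\<dots> \<le> step_weight F n m ?C (insert v ?C)"
      using u Cn by (intro step_weight_ge) auto
    finally show ?thesis .
  qed
  then have st: "growth_weight F n m (j + card R) ?C * (1 / (k * D v)) \<le> growth_weight F n m (Suc (j + card R)) (insert v ?C)"
    using Cn by (intro growth_weight_step)
  have IH: "growth_weight F n m j B * (\<Prod>r\<in>R. 1 / (k * D r)) \<le> growth_weight F n m (j + card R) ?C"
    using insert.prems cC by (intro insert.IH) auto
  have "growth_weight F n m j B * (\<Prod>r\<in>insert v R. 1 / (k * D r)) =
      growth_weight F n m j B * (\<Prod>r\<in>R. 1 / (k * D r)) * (1 / (k * D v))"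
    using insert by simp
  also have "\<dots> \<le> growth_weight F n m (j + card R) ?C * (1 / (k * D v))"
    using IH Dv by (intro mult_right_mono) auto
  finally show ?case using st insert by simp
qed

end

section \<open>The cost of a vertex set\<close>

text \<open>The junk value \<open>log n 0\<close> does not occur in the cost: vertices of the high part and vertices that
  have a neighbour have positive degree.\<close>

definition high_part :: "edge_set \<Rightarrow> nat \<Rightarrow> real \<Rightarrow> nat set \<Rightarrow> nat set" where
  "high_part F n \<delta> K = {u \<in> K. real n powr (\<delta> / 2) \<le> vdeg F u}"

definition fringe_part :: "edge_set \<Rightarrow> nat \<Rightarrow> real \<Rightarrow> nat set \<Rightarrow> nat set" where
  "fringe_part F n \<delta> K = {r \<in> K. vdeg F r < real n powr (\<delta> / 2) \<and>
     (\<forall>u\<in>K. {u, r} \<in> F \<longrightarrow> real n powr (\<delta> / 2) \<le> vdeg F u)}"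

text \<open>The inserted 1 is the exponent of a free choice among all \<open>n\<close> vertices; it
  also keeps the set under \<open>Min\<close> nonempty.\<close>

definition fringe_cost :: "edge_set \<Rightarrow> nat \<Rightarrow> nat set \<Rightarrow> nat \<Rightarrow> real" where
  "fringe_cost F n K r = Min (insert 1 ((\<lambda>u. log n (vdeg F u)) ` {u \<in> K. {u, r} \<in> F}))"

text \<open>Up to lower-order factors, this is minus the base-\<open>n\<close> logarithm of the
  weight of one growth path to \<open>K\<close> with \<open>m = n powr \<delta>\<close>.\<close>

definition cost :: "edge_set \<Rightarrow> nat \<Rightarrow> real \<Rightarrow> nat set \<Rightarrow> real" where
  "cost F n \<delta> K =
     (\<Sum>u\<in>high_part F n \<delta> K. \<delta> - log n (vdeg F u)) +
     \<delta> / 2 * card (K - high_part F n \<delta> K - fringe_part F n \<delta> K) +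
     (\<Sum>r\<in>fringe_part F n \<delta> K. fringe_cost F n K r)"

lemma high_fringe:
  "high_part F n \<delta> K \<subseteq> K" "fringe_part F n \<delta> K \<subseteq> K" "high_part F n \<delta> K \<inter> fringe_part F n \<delta> K = {}"
  by (auto simp: high_part_def fringe_part_def)

lemma card_parts:
  assumes "finite K"
  shows "card K = card (high_part F n \<delta> K) + card (K - high_part F n \<delta> K - fringe_part F n \<delta> K)
    + card (fringe_part F n \<delta> K)"
proof -
  have fin: "finite (high_part F n \<delta> K)" "finite (fringe_part F n \<delta> K)"
    using assms high_fringe finite_subset by metis+
  have "card (high_part F n \<delta> K \<union> (K - high_part F n \<delta> K - fringe_part F n \<delta> K) \<union> fringe_part F n \<delta> K) =
    card (high_part F n \<delta> K) + card (K - high_part F n \<delta> K - fringe_part F n \<delta> K) + card (fringe_part F n \<delta> K)"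
    using assms fin high_fringe(3)[of F n \<delta> K] by (subst card_Un_disjoint; auto)+
  moreover have "high_part F n \<delta> K \<union> (K - high_part F n \<delta> K - fringe_part F n \<delta> K) \<union> fringe_part F n \<delta> K = K"
    using high_fringe(1,2)[of F n \<delta> K] by auto
  ultimately show ?thesis by simp
qed

section \<open>Counting cheap sets and splitting expensive ones\<close>

context
  fixes F :: edge_set and n :: nat and \<delta> :: real
  assumes F: "F \<subseteq> nsets {..<n} 2" and cF: "real (card F) \<le> real n powr \<delta>" and n: "2 \<le> n"
begin

text \<open>\<open>K\<close> is grown in the order high part, remaining vertices, fringe. One factor
  \<open>1 / (2 * k)\<close> per vertex absorbs both the 2 in the degree move and the choice of an
  earlier vertex.\<close>

lemma growth_weight_ge_cost:
  assumes K: "K \<subseteq> {..<n}" "card K = k" and k: "1 \<le> k"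
  shows "(1 / (2 * real k)) ^ k * real n powr (- cost F n \<delta> K) \<le> growth_weight F n (real n powr \<delta>) k K"
proof -
  let ?H = "high_part F n \<delta> K" and ?R = "fringe_part F n \<delta> K"
  let ?T = "K - ?H - ?R" and ?m = "real n powr \<delta>" and ?b = "real n powr (\<delta> / 2)"
  let ?W = "growth_weight F n ?m" and ?c = "1 / (2 * real k)"
  have m: "0 < ?m" and n0: "0 < n" using n by auto
  have finK: "finite K" using K finite_subset by blast
  have fin: "finite ?H" "finite ?R" "finite ?T"
    using finK high_fringe finite_subset by (metis, metis, simp)
  have cost_eq: "real n powr (- cost F n \<delta> K) = (\<Prod>u\<in>?H. real n powr (log n (vdeg F u) - \<delta>)) *
      (real n powr (- (\<delta> / 2))) ^ card ?T * (\<Prod>r\<in>?R. real n powr (- fringe_cost F n K r))"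
  proof -
    have "- cost F n \<delta> K = (\<Sum>u\<in>?H. log n (vdeg F u) - \<delta>) + (- (\<delta> / 2)) * card ?T +
        (\<Sum>r\<in>?R. - fringe_cost F n K r)"
      by (simp add: cost_def sum_subtractf sum_negf)
    moreover have "real n powr (- (\<delta> / 2) * card ?T) = (real n powr (- (\<delta> / 2))) ^ card ?T"
      by (subst powr_realpow[symmetric]) (use n0 in \<open>simp_all add: powr_powr\<close>)
    ultimately show ?thesis using n0 fin by (simp only: powr_add powr_sum)
  qed
  have H: "?c ^ card ?H * (\<Prod>u\<in>?H. real n powr (log n (vdeg F u) - \<delta>)) \<le> ?W (card ?H) ?H"
  proof -
    have "?c ^ card ?H * (\<Prod>u\<in>?H. real n powr (log n (vdeg F u) - \<delta>)) =
      (\<Prod>u\<in>?H. ?c * real n powr (log n (vdeg F u) - \<delta>))"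
      by (simp only: prod.distrib prod_constant)
    also have "\<dots> \<le> (\<Prod>u\<in>?H. vdeg F u / (2 * ?m))"
    proof (rule prod_mono, intro conjI)
      fix u assume u: "u \<in> ?H"
      have "0 < ?b" using n0 by simp
      moreover have "?b \<le> vdeg F u" using u by (simp add: high_part_def)
      ultimately have "0 < real (vdeg F u)" by linarith
      then have eq: "real n powr (log n (vdeg F u) - \<delta>) = vdeg F u / ?m"
        using n by (simp add: powr_diff)
      have "?c \<le> 1 / 2" using k by (simp add: field_simps)
      then have "?c * real n powr (log n (vdeg F u) - \<delta>) \<le> 1 / 2 * (vdeg F u / ?m)"
        unfolding eq by (rule mult_right_mono) simp
      then show "?c * real n powr (log n (vdeg F u) - \<delta>) \<le> vdeg F u / (2 * ?m)" by simp
    qed simp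
    also have "\<dots> \<le> ?W (card ?H) ?H"
      using K fin high_fringe(1)[of F n \<delta> K] by (intro growth_weight_by_degree[OF F m cF n0]) auto
    finally show ?thesis .
  qed
  have T: "?W (card ?H) ?H * (1 / (k * ?b)) ^ card (?T - ?H) \<le> ?W (card ?H + card (?T - ?H)) (?H \<union> ?T)"
  proof (rule growth_weight_low_degree[OF F m cF n0])
    show "?T \<subseteq> {..<n}" "?H \<subseteq> {..<n}" using K high_fringe(1)[of F n \<delta> K] by auto
    show "card (?H \<union> ?T) \<le> k"
      using finK K(2) high_fringe(1)[of F n \<delta> K] by (metis Un_Diff_cancel Un_Diff Un_subset_iff card_mono Diff_subset subset_trans)
    show "0 < ?b" using n0 by simp
    show "?m \<le> ?b\<^sup>2" using n0 by (simp add: powr_power)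
    show "real (vdeg F u) \<le> ?b" if "u \<in> ?T" for u
      using that by (auto simp: high_part_def)
    show "\<exists>u\<in>?T. {u, v} \<in> F" if v: "v \<in> ?T" for v
    proof -
      have lv: "vdeg F v < ?b" using v by (auto simp: high_part_def)
      then obtain u where u: "u \<in> K" "{u, v} \<in> F" "vdeg F u < ?b"
        using v by (auto simp: fringe_part_def not_le)
      \<comment> \<open>\<open>u\<close> has the low-degree neighbour \<open>v\<close> in
        \<open>K\<close>, so it is not in the fringe and lies in \<open>?T\<close> itself.\<close>
      moreover have "u \<notin> ?R" using u v lv unfolding fringe_part_def
        by (auto simp: insert_commute)
      ultimately show ?thesis by (auto simp: high_part_def)
    qed
  qed
  have R: "?W (card ?H + card ?T) (?H \<union> ?T) * (\<Prod>r\<in>?R. 1 / (k * real n powr fringe_cost F n K r)) \<le>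
      ?W (card ?H + card ?T + card ?R) (?H \<union> ?T \<union> ?R)"
  proof (rule growth_weight_neighbours[OF F m cF n0])
    show "finite ?R" by fact
    show "?R \<subseteq> {..<n}" "?H \<union> ?T \<subseteq> {..<n}" "?R \<inter> (?H \<union> ?T) = {}"
      using K high_fringe[of F n \<delta> K] by auto
    have "?H \<union> ?T \<union> ?R = K" using high_fringe[of F n \<delta> K] by auto
    then show "card (?H \<union> ?T \<union> ?R) \<le> k" using K by simp
    fix r assume r: "r \<in> ?R"
    let ?f = "fringe_cost F n K r"
    have "finite (insert 1 ((\<lambda>u. log n (vdeg F u)) ` {u \<in> K. {u, r} \<in> F}))" using finK by simp
    from Min_in[OF this]
    have "?f \<in> insert 1 ((\<lambda>u. log n (vdeg F u)) ` {u \<in> K. {u, r} \<in> F})"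
      unfolding fringe_cost_def by blast
    then consider "?f = 1" | u where "u \<in> K" "{u, r} \<in> F" "?f = log n (vdeg F u)" by auto
    then have "real n \<le> real n powr ?f \<or> (\<exists>u\<in>?H \<union> ?T. {u, r} \<in> F \<and> real (vdeg F u) \<le> real n powr ?f)"
    proof cases
      case 1 then show ?thesis by simp
    next
      case 2
      then have "real (vdeg F u) = real n powr ?f"
        using vdeg_pos[OF F 2(2)] n by simp
      moreover have "u \<in> ?H" using 2 r by (auto simp: fringe_part_def high_part_def)
      ultimately show ?thesis using 2 by auto
    qed
    then show "0 < real n powr ?f \<and> (real n \<le> real n powr ?f \<or> (\<exists>u\<in>?H \<union> ?T. {u, r} \<in> F \<and> real (vdeg F u) \<le> real n powr ?f))"
      using n0 by simp
  qed
  have ck: "?c \<le> 1 / k" using k by (simp add: field_simps)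
  have TH: "?T - ?H = ?T" by auto
  have pow: "?c ^ k = ?c ^ card ?H * ?c ^ card ?T * ?c ^ card ?R"
    using card_parts[OF finK, of F n \<delta>] K(2) by (simp only: power_add[symmetric])
  have "(1 / (2 * real k)) ^ k * real n powr (- cost F n \<delta> K) =
      (?c ^ card ?H * (\<Prod>u\<in>?H. real n powr (log n (vdeg F u) - \<delta>))) *
      (?c * real n powr (- (\<delta> / 2))) ^ card ?T * (\<Prod>r\<in>?R. ?c * real n powr (- fringe_cost F n K r))"
    unfolding cost_eq pow prod.distrib prod_constant power_mult_distrib by (simp only: mult_ac)
  also have "\<dots> \<le> (?W (card ?H) ?H * (1 / (k * ?b)) ^ card ?T) * (\<Prod>r\<in>?R. 1 / (k * real n powr fringe_cost F n K r))"
  proof (intro mult_mono H power_mono prod_mono conjI)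
    show "?c * real n powr (- (\<delta> / 2)) \<le> 1 / (k * ?b)"
      using mult_right_mono[OF ck, of "1 / ?b"] by (simp add: powr_minus_divide)
    show "?c * real n powr (- fringe_cost F n K r) \<le> 1 / (k * real n powr fringe_cost F n K r)" for r
      using mult_right_mono[OF ck, of "1 / real n powr fringe_cost F n K r"] by (simp add: powr_minus_divide)
  qed (auto intro!: prod_nonneg mult_nonneg_nonneg growth_weight_nonneg[OF F m cF n0])
  also have "\<dots> \<le> ?W (card ?H + card ?T) (?H \<union> ?T) * (\<Prod>r\<in>?R. 1 / (k * real n powr fringe_cost F n K r))"
    using T[unfolded TH] by (intro mult_right_mono) (auto intro!: prod_nonneg)
  also note R
  also have "?H \<union> ?T \<union> ?R = K" using high_fringe[of F n \<delta> K] by auto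
  also have "card ?H + card ?T + card ?R = k" using card_parts[OF finK, of F n \<delta>] K by simp
  finally show ?thesis .
qed

text \<open>Markov-type count: each such set has weight at least
  \<open>(1 / (2 * k)) ^ k * n powr (- c)\<close>, while all weights sum to at most
  \<open>5 ^ k\<close>.\<close>

lemma card_cheap_sets_le:
  assumes k: "1 \<le> k"
  shows "real (card {K. K \<subseteq> {..<n} \<and> card K = k \<and> cost F n \<delta> K \<le> c}) \<le> (10 * real k) ^ k * real n powr c"
proof -
  let ?A = "{K. K \<subseteq> {..<n} \<and> card K = k \<and> cost F n \<delta> K \<le> c}"
  let ?m = "real n powr \<delta>"
  have m: "0 < ?m" and n0: "0 < n" using n by auto
  have "card ?A * ((1 / (2 * real k)) ^ k * real n powr (- c)) \<le> (\<Sum>K\<in>?A. growth_weight F n ?m k K)"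
  proof (rule order_trans[OF _ sum_mono])
    fix K assume K: "K \<in> ?A"
    have "(1 / (2 * real k)) ^ k * real n powr (- c) \<le> (1 / (2 * real k)) ^ k * real n powr (- cost F n \<delta> K)"
      using K n by (intro mult_left_mono powr_mono) auto
    also have "\<dots> \<le> growth_weight F n ?m k K"
      using K k by (intro growth_weight_ge_cost) auto
    finally show "(1 / (2 * real k)) ^ k * real n powr (- c) \<le> growth_weight F n ?m k K" .
  qed simp
  also have "\<dots> \<le> (\<Sum>K\<in>Pow {..<n}. growth_weight F n ?m k K)"
    by (intro sum_mono2) (auto intro: growth_weight_nonneg[OF F m cF n0])
  also have "\<dots> \<le> 5 ^ k" by (rule sum_growth_weight_le[OF F m cF n0])
  finally have "card ?A * ((1 / (2 * real k)) ^ k * real n powr (- c)) * ((2 * real k) ^ k * real n powr c) \<le>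
      5 ^ k * ((2 * real k) ^ k * real n powr c)"
    by (intro mult_right_mono) auto
  moreover have "((1 / (2 * real k)) ^ k * real n powr (- c)) * ((2 * real k) ^ k * real n powr c) = 1"
  proof -
    have 1: "(1 / (2 * real k)) ^ k * (2 * real k) ^ k = 1"
      unfolding power_mult_distrib[symmetric] using k by simp
    have 2: "real n powr (- c) * real n powr c = 1"
      unfolding powr_add[symmetric] using n0 by simp
    have 3: "(a * b) * (c * d) = (a * c) * (b * d)" for a b c d :: real by simp
    show ?thesis by (subst 3) (simp only: 1 2 mult_1)
  qed
  moreover have "5 ^ k * ((2 * real k) ^ k * real n powr c) = (10 * real k) ^ k * real n powr c"
    unfolding mult.assoc[symmetric] power_mult_distrib[symmetric] by simp
  ultimately show ?thesis by (simp only: mult.assoc mult_1_right)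
qed

text \<open>The total cost exceeds \<open>\<delta> / 2 * card K\<close> by the integral over thresholds \<open>t \<in> {\<delta> / 2..1}\<close> of
  the number of fringe vertices of cost above \<open>t\<close> minus the number of vertices of degree above
  \<open>n powr t\<close>.\<close>

lemma expensive_set_partition:
  assumes K: "K \<subseteq> {..<n}" and \<delta>: "\<delta> < 2"
    and c: "\<delta> / 2 * card K + (1 - \<delta> / 2) * Y < cost F n \<delta> K"
  obtains P R where "P \<subseteq> K" "R \<subseteq> K" "P \<inter> R = {}" "Y \<le> real (card R) - real (card P)"
    "\<And>u r. r \<in> R \<Longrightarrow> u \<in> K \<Longrightarrow> {u, r} \<in> F \<Longrightarrow> u \<in> P"
proof -
  let ?H = "high_part F n \<delta> K" and ?R = "fringe_part F n \<delta> K"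
  let ?d = "\<lambda>u. log n (vdeg F u)" and ?f = "fringe_cost F n K"
  have finK: "finite K" using K finite_subset by blast
  have fin: "finite ?H" "finite ?R"
    using finK high_fringe finite_subset by metis+
  have n1: "1 < real n" using n by simp
  have d: "?d u \<in> {\<delta> / 2..1}" if "real n powr (\<delta> / 2) \<le> vdeg F u" for u
  proof -
    have "0 < real n powr (\<delta> / 2)" using n by simp
    then have pos: "0 < real (vdeg F u)" using that by linarith
    have "?d u \<le> log n n" using pos vdeg_le[OF F, of u] n by (subst log_le_cancel_iff) auto
    moreover have "log n (real n powr (\<delta> / 2)) \<le> ?d u"
      using that pos n by (subst log_le_cancel_iff) auto
    ultimately show ?thesis using n1 by simp
  qed
  have f: "?f r \<in> {\<delta> / 2..1}" if "r \<in> ?R" for r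
  proof -
    have "\<delta> / 2 \<le> ?f r"
      unfolding fringe_cost_def using finK that \<delta> d by (subst Min_ge_iff) (auto simp: fringe_part_def)
    moreover have "?f r \<le> 1" unfolding fringe_cost_def using finK by (intro Min_le) auto
    ultimately show ?thesis by simp
  qed
  \<comment> \<open>Subtracting \<open>\<delta> / 2\<close> per vertex cancels the middle term of
    the cost and leaves \<open>\<delta> / 2 - ?d u\<close> for a high vertex and
    \<open>?f r - \<delta> / 2\<close> for a fringe vertex.\<close>
  have "(\<Sum>r\<in>?R. ?f r - \<delta> / 2) - (\<Sum>u\<in>?H. ?d u - \<delta> / 2) = cost F n \<delta> K - \<delta> / 2 * card K"
    unfolding cost_def card_parts[OF finK, of F n \<delta>] by (simp add: sum_subtractf algebra_simps)
  then have "(1 - \<delta> / 2) * Y < (\<Sum>r\<in>?R. ?f r - \<delta> / 2) - (\<Sum>u\<in>?H. ?d u - \<delta> / 2)"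
    using c by simp
  then obtain t where t: "Y \<le> real (card {r \<in> ?R. t < ?f r}) - real (card {u \<in> ?H. t < ?d u})"
  proof (rule exists_threshold_card_diff[OF fin(2,1) _ f, rotated 3])
    show "\<delta> / 2 < 1" using \<delta> by simp
    show "?d u \<in> {\<delta> / 2..1}" if "u \<in> ?H" for u
      using that by (intro d) (simp add: high_part_def)
  qed
  show ?thesis
  proof (rule that[OF _ _ _ t])
    show "{u \<in> ?H. t < ?d u} \<subseteq> K" "{r \<in> ?R. t < ?f r} \<subseteq> K"
      "{u \<in> ?H. t < ?d u} \<inter> {r \<in> ?R. t < ?f r} = {}"
      using high_fringe[of F n \<delta> K] by auto
    fix u r assume r: "r \<in> {r \<in> ?R. t < ?f r}" and u: "u \<in> K" "{u, r} \<in> F"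
    \<comment> \<open>Being a minimum over neighbours, the fringe cost passes the threshold on to
      \<open>u\<close>, which has high degree because \<open>r\<close> is in the fringe.\<close>
    have "?f r \<le> ?d u" unfolding fringe_cost_def using finK u by (intro Min_le) auto
    then show "u \<in> {u \<in> ?H. t < ?d u}" using r u by (auto simp: high_part_def fringe_part_def)
  qed
qed

end

section \<open>Cliques found in two rounds\<close>

text \<open>\<open>S\<close> is listed with \<open>Q\<close> first, and position \<open>i\<close> is
  matched with \<open>i + h\<close>, where \<open>h = card S div 2\<close>. As
  \<open>card Q \<le> h\<close>, the second partner is never in \<open>Q\<close>, so no matched pair
  lies inside \<open>Q\<close>. The vertex \<open>z\<close> takes care of odd
  \<open>card S\<close>.\<close>

lemma near_perfect_matching_cover:
  fixes S Q :: "nat set"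
  assumes S: "finite S" "S \<noteq> {}" and Q: "Q \<subseteq> S" "2 * card Q \<le> card S"
    and M: "nsets S 2 - nsets Q 2 \<subseteq> M"
  shows "\<exists>es z. set es \<subseteq> M \<and> length es = card S div 2 \<and> z \<in> S \<and> S = insert z (\<Union>(set es))"
proof -
  define xs where "xs = sorted_list_of_set Q @ sorted_list_of_set (S - Q)"
  define h where "h = card S div 2"
  have finQ: "finite Q" using S Q finite_subset by blast
  have xs: "distinct xs" "set xs = S" using S finQ Q by (auto simp: xs_def)
  then have len: "length xs = card S" using distinct_card by metis
  have notQ: "xs ! i \<notin> Q" if "h \<le> i" "i < card S" for i
  proof -
    have "card Q \<le> i" using Q(2) that by (simp add: h_def)
    then have "xs ! i = sorted_list_of_set (S - Q) ! (i - card Q)"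
      by (simp add: xs_def nth_append)
    moreover have "i - card Q < length (sorted_list_of_set (S - Q))"
      using that \<open>card Q \<le> i\<close> S finQ Q by (simp add: card_Diff_subset)
    ultimately have "xs ! i \<in> set (sorted_list_of_set (S - Q))" using nth_mem by metis
    then show ?thesis using S by simp
  qed
  let ?es = "map (\<lambda>i. {xs ! i, xs ! (i + h)}) [0..<h]"
  have lt: "i < card S" "i + h < card S" if "i < h" for i using that unfolding h_def by linarith+
  have "set ?es \<subseteq> M"
  proof
    fix e assume "e \<in> set ?es"
    then obtain i where i: "i < h" "e = {xs ! i, xs ! (i + h)}" by auto
    have "xs ! i \<noteq> xs ! (i + h)"
      using lt[OF i(1)] i xs len nth_eq_iff_index_eq by fastforce
    moreover have "xs ! i \<in> S" "xs ! (i + h) \<in> S" using lt[OF i(1)] xs len nth_mem by metis+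
    moreover have "xs ! (i + h) \<notin> Q" using lt[OF i(1)] by (intro notQ) auto
    ultimately have "e \<in> nsets S 2 - nsets Q 2" using i by (auto simp: nsets_def)
    then show "e \<in> M" using M by blast
  qed
  moreover have "card S > 0" using S by (auto simp: card_gt_0_iff)
  then have zS: "xs ! (card S - 1) \<in> S" using xs len nth_mem by (metis diff_less zero_less_one)
  moreover have "S = insert (xs ! (card S - 1)) (\<Union>(set ?es))"
  proof
    show "insert (xs ! (card S - 1)) (\<Union>(set ?es)) \<subseteq> S"
      using zS lt xs len nth_mem by fastforce
    show "S \<subseteq> insert (xs ! (card S - 1)) (\<Union>(set ?es))"
    proof
      fix x assume "x \<in> S"
      then obtain i where i: "i < card S" "x = xs ! i" using xs len by (metis in_set_conv_nth)
      consider "i < h" | "h \<le> i" "i < 2 * h" | "i = card S - 1"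
        using i(1) unfolding h_def by linarith
      then show "x \<in> insert (xs ! (card S - 1)) (\<Union>(set ?es))"
      proof cases
        case 1 then show ?thesis using i by auto
      next
        case 2
        then have "i - h < h" "i - h + h = i" by auto
        then have "x \<in> {xs ! (i - h), xs ! (i - h + h)}" "i - h \<in> {0..<h}" using i by auto
        then show ?thesis by auto
      qed (use i in auto)
    qed
  qed
  moreover have "length ?es = card S div 2" by (simp add: h_def)
  ultimately show ?thesis by blast
qed

text \<open>\<open>S\<close> is recovered from one vertex and a list of \<open>s div 2\<close> pairs
  of \<open>M\<close>, so a vertex costs only about the square root of
  \<open>card M\<close>.\<close>

lemma card_near_matched_sets_le:
  assumes M: "finite M" and s: "1 \<le> s"
  shows "card {S. S \<subseteq> {..<n} \<and> card S = s \<and> (\<exists>Q\<subseteq>S. 2 * card Q \<le> s \<and> nsets S 2 - nsets Q 2 \<subseteq> M)}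
    \<le> n * card M ^ (s div 2)"
proof -
  let ?A = "{S. S \<subseteq> {..<n} \<and> card S = s \<and> (\<exists>Q\<subseteq>S. 2 * card Q \<le> s \<and> nsets S 2 - nsets Q 2 \<subseteq> M)}"
  let ?D = "{..<n} \<times> {es. set es \<subseteq> M \<and> length es = s div 2}"
  have fin: "finite ?D" using M by (simp add: finite_lists_length_eq)
  have "?A \<subseteq> (\<lambda>(z, es). insert z (\<Union>(set es))) ` ?D"
  proof
    fix S assume "S \<in> ?A"
    then obtain Q where S: "S \<subseteq> {..<n}" "card S = s" and Q: "Q \<subseteq> S" "2 * card Q \<le> card S"
      "nsets S 2 - nsets Q 2 \<subseteq> M" by blast
    have "finite S" using S finite_subset by blast
    moreover have "S \<noteq> {}" using S s by auto
    ultimately obtain es z where "set es \<subseteq> M" "length es = card S div 2" "z \<in> S"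
      "S = insert z (\<Union>(set es))"
      using near_perfect_matching_cover[OF _ _ Q] by blast
    then show "S \<in> (\<lambda>(z, es). insert z (\<Union>(set es))) ` ?D"
      using S by (intro image_eqI[where x="(z, es)"]) auto
  qed
  then have "card ?A \<le> card ?D" using fin by (rule surj_card_le[rotated])
  then show ?thesis using M by (simp add: card_cartesian_product card_lists_length_eq)
qed

section \<open>Union bounds for second-round pairs and for cheap cliques\<close>

lemma card_pairs_diff:
  assumes "finite S" "Q \<subseteq> S"
  shows "card (nsets S 2 - nsets Q 2) = (card S choose 2) - (card Q choose 2)"
proof -
  have "nsets Q 2 \<subseteq> nsets S 2" using assms by (auto simp: nsets_def)
  moreover have "finite (nsets Q 2)" using assms finite_subset by (blast intro: finite_imp_finite_nsets)
  ultimately show ?thesis by (simp add: card_Diff_subset card_nsets)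
qed

text \<open>Revealing the answers on \<open>F1\<close> fixes \<open>F2 (F1 \<inter> G)\<close>,
  while the pairs in question lie outside \<open>F1\<close> and stay random. The factor
  \<open>n * m ^ (s div 2)\<close> counts the choices of \<open>S\<close>, and \<open>2 ^ s\<close>
  those of \<open>Q\<close>.\<close>

lemma prob_second_round_le:
  assumes F1: "F1 \<subseteq> nsets {..<n} 2"
    and F2: "\<And>H. H \<subseteq> F1 \<Longrightarrow> F2 H \<subseteq> nsets {..<n} 2 \<and> real (card (F2 H)) \<le> m"
    and s: "1 \<le> s" and q: "2 * q \<le> s"
  shows "measure_pmf.prob (random_graph n (1/2))
     {G. \<exists>S Q. Q \<subseteq> S \<and> S \<subseteq> {..<n} \<and> card S = s \<and> card Q = q \<and>
        nsets S 2 - nsets Q 2 \<subseteq> (F2 (F1 \<inter> G) - F1) \<inter> G}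
     \<le> n * m ^ (s div 2) * 2 ^ s / 2 ^ ((s choose 2) - (q choose 2))"
    (is "measure_pmf.prob _ ?B \<le> _")
proof -
  let ?P = "\<lambda>H. {nsets S 2 - nsets Q 2 |S Q. Q \<subseteq> S \<and> S \<subseteq> {..<n} \<and> card S = s \<and> card Q = q \<and>
        nsets S 2 - nsets Q 2 \<subseteq> F2 H - F1}"
  let ?E = "nsets {..<n} 2"
  have finE: "finite ?E" by (simp add: finite_imp_finite_nsets)
  have "measure_pmf.prob (pmf_of_set (Pow ?E)) {G. \<exists>X\<in>?P (F1 \<inter> G). X \<subseteq> G}
     \<le> (n * m ^ (s div 2) * 2 ^ s) / 2 ^ ((s choose 2) - (q choose 2))"
  proof (rule prob_contains_revealed_le[OF finE F1])
    fix H assume H: "H \<subseteq> F1"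
    show "X \<subseteq> ?E - F1" if "X \<in> ?P H" for X using that F2[OF H] by blast
    show "(s choose 2) - (q choose 2) \<le> card X" if X: "X \<in> ?P H" for X
    proof -
      obtain S Q where "X = nsets S 2 - nsets Q 2" "Q \<subseteq> S" "S \<subseteq> {..<n}" "card S = s" "card Q = q"
        using X by blast
      then show ?thesis using card_pairs_diff[of S Q] finite_subset[of S "{..<n}"] by simp
    qed
    \<comment> \<open>Relaxing to \<open>F2 H\<close> and to \<open>2 * card Q \<le> s\<close> puts
      the candidates into the form counted by \<open>card_near_matched_sets_le\<close>.\<close>
    let ?A = "{S. S \<subseteq> {..<n} \<and> card S = s \<and> (\<exists>Q\<subseteq>S. 2 * card Q \<le> s \<and> nsets S 2 - nsets Q 2 \<subseteq> F2 H)}"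
    have finA: "finite ?A" by (rule finite_subset[of _ "Pow {..<n}"]) auto
    have finS: "\<forall>S\<in>?A. finite (Pow S)" using finite_subset by auto
    have "?P H \<subseteq> (\<lambda>(S, Q). nsets S 2 - nsets Q 2) ` (SIGMA S:?A. Pow S)"
    proof
      fix X assume "X \<in> ?P H"
      then obtain S Q where X: "X = nsets S 2 - nsets Q 2" "Q \<subseteq> S" "S \<subseteq> {..<n}" "card S = s" "card Q = q"
        "nsets S 2 - nsets Q 2 \<subseteq> F2 H - F1" by blast
      have "\<exists>Q\<subseteq>S. 2 * card Q \<le> s \<and> nsets S 2 - nsets Q 2 \<subseteq> F2 H"
        by (rule exI[of _ Q]) (use X q in blast)
      then have "(S, Q) \<in> (SIGMA S:?A. Pow S)" using X(2-4) by simp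
      then show "X \<in> (\<lambda>(S, Q). nsets S 2 - nsets Q 2) ` (SIGMA S:?A. Pow S)"
        by (rule image_eqI[rotated]) (simp add: X(1))
    qed
    moreover have "finite (SIGMA S:?A. Pow S)"
      by (rule finite_SigmaI[OF finA]) (rule finS[rule_format])
    ultimately have "card (?P H) \<le> card (SIGMA S:?A. Pow S)"
      by (intro surj_card_le)
    also have "\<dots> = (\<Sum>S\<in>?A. card (Pow S))" using finA finS by (rule card_SigmaI)
    also have "\<dots> = (\<Sum>S\<in>?A. 2 ^ s)"
    proof (rule sum.cong)
      fix S assume "S \<in> ?A"
      then have "finite S" "card S = s" using finite_subset[of S "{..<n}"] by auto
      then show "card (Pow S) = 2 ^ s" by (simp add: card_Pow)
    qed simp
    also have "\<dots> = card ?A * 2 ^ s" by simp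
    also have "\<dots> \<le> n * card (F2 H) ^ (s div 2) * 2 ^ s"
      using F2[OF H] finE finite_subset s by (intro mult_right_mono card_near_matched_sets_le) auto
    finally have "real (card (?P H)) \<le> real (n * card (F2 H) ^ (s div 2) * 2 ^ s)"
      by (rule of_nat_mono)
    also have "\<dots> = n * real (card (F2 H)) ^ (s div 2) * 2 ^ s" by simp
    also have "\<dots> \<le> n * m ^ (s div 2) * 2 ^ s"
      using F2[OF H] by (intro mult_right_mono mult_left_mono power_mono) auto
    finally show "real (card (?P H)) \<le> n * m ^ (s div 2) * 2 ^ s" .
  qed
  moreover have "?B \<subseteq> {G. \<exists>X\<in>?P (F1 \<inter> G). X \<subseteq> G}"
  proof
    fix G assume "G \<in> ?B"
    then obtain S Q where SQ: "Q \<subseteq> S" "S \<subseteq> {..<n}" "card S = s" "card Q = q"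
      "nsets S 2 - nsets Q 2 \<subseteq> (F2 (F1 \<inter> G) - F1) \<inter> G" by blast
    have X: "nsets S 2 - nsets Q 2 \<in> ?P (F1 \<inter> G)" "nsets S 2 - nsets Q 2 \<subseteq> G"
      using SQ by blast+
    show "G \<in> {G. \<exists>X\<in>?P (F1 \<inter> G). X \<subseteq> G}" by (rule CollectI, rule bexI[OF _ X(1)], rule X(2))
  qed
  then have "measure_pmf.prob (pmf_of_set (Pow ?E)) ?B \<le>
      measure_pmf.prob (pmf_of_set (Pow ?E)) {G. \<exists>X\<in>?P (F1 \<inter> G). X \<subseteq> G}"
    by (intro measure_pmf.finite_measure_mono) auto
  ultimately show ?thesis unfolding random_graph_half by linarith
qed

text \<open>\<open>F\<close> is fixed before \<open>G\<close> is drawn, so this is the union bound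
  with empty revealed set over the sets counted by \<open>card_cheap_sets_le\<close>.\<close>

lemma prob_cheap_clique_le:
  assumes F: "F \<subseteq> nsets {..<n} 2" "real (card F) \<le> real n powr \<delta>" and n: "2 \<le> n" and k: "1 \<le> k"
  shows "measure_pmf.prob (random_graph n (1/2))
     {G. \<exists>K. K \<subseteq> {..<n} \<and> card K = k \<and> cost F n \<delta> K \<le> c \<and> nsets K 2 \<subseteq> G}
     \<le> (10 * real k) ^ k * real n powr c / 2 ^ (k choose 2)"
proof -
  let ?A = "{K. K \<subseteq> {..<n} \<and> card K = k \<and> cost F n \<delta> K \<le> c}"
  let ?E = "nsets {..<n} 2"
  have finE: "finite ?E" by (simp add: finite_imp_finite_nsets)
  have finA: "finite ?A" by (rule finite_subset[of _ "Pow {..<n}"]) auto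
  have "measure_pmf.prob (pmf_of_set (Pow ?E)) {G. \<exists>X\<in>(\<lambda>K. nsets K 2) ` ?A. X \<subseteq> G}
     \<le> ((10 * real k) ^ k * real n powr c) / 2 ^ (k choose 2)"
  proof (rule prob_contains_revealed_le[OF finE empty_subsetI, of "\<lambda>_. (\<lambda>K. nsets K 2) ` ?A"])
    show "X \<subseteq> ?E - {}" if "X \<in> (\<lambda>K. nsets K 2) ` ?A" for X
      using that by (auto simp: nsets_def)
    show "(k choose 2) \<le> card X" if "X \<in> (\<lambda>K. nsets K 2) ` ?A" for X
      using that by (auto simp: card_nsets)
    have "real (card ((\<lambda>K. nsets K 2) ` ?A)) \<le> real (card ?A)"
      using finA by (intro of_nat_mono card_image_le)
    also have "\<dots> \<le> (10 * real k) ^ k * real n powr c" by (rule card_cheap_sets_le[OF F n k])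
    finally show "real (card ((\<lambda>K. nsets K 2) ` ?A)) \<le> (10 * real k) ^ k * real n powr c" .
  qed
  moreover have "{G. \<exists>K. K \<subseteq> {..<n} \<and> card K = k \<and> cost F n \<delta> K \<le> c \<and> nsets K 2 \<subseteq> G} =
      {G. \<exists>X\<in>(\<lambda>K. nsets K 2) ` ?A. X \<subseteq> G}" by blast
  ultimately show ?thesis by (simp only: random_graph_half)
qed

section \<open>Combining the cheap and the expensive case\<close>

lemma clique_imp_nsets_subset: "clique K E \<Longrightarrow> nsets K 2 \<subseteq> E"
  by (auto simp: clique_def nsets_def card_2_iff)

lemma found_graph_2: "found_graph A G 2 = (A [] \<inter> G) \<union> (A [A [] \<inter> G] \<inter> G)"
  by (auto simp: found_graph_def queries_def numeral_2_eq_2 less_Suc_eq)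

text \<open>A \<open>k\<close>-subset \<open>K\<close> of the clique is either cheap or split by
  \<open>expensive_set_partition\<close>. With \<open>s = card (K - P)\<close> and
  \<open>q = s - card R\<close>, the gap \<open>card R - card P\<close> equals
  \<open>2 * s - q - k\<close>; hence the index set of the sum.\<close>

lemma prob_two_round_clique_le:
  fixes A :: strategy and Y :: real
  assumes q: "\<And>G i. G \<subseteq> nsets {..<n} 2 \<Longrightarrow> i < 2 \<Longrightarrow>
        queries A G i \<subseteq> nsets {..<n} 2 \<and> real (card (queries A G i)) \<le> real n powr \<delta>"
    and n: "2 \<le> n" and k: "1 \<le> k" and \<delta>: "\<delta> < 2"
    and small: "\<And>s q. s \<le> k \<Longrightarrow> q \<le> s \<Longrightarrow> Y \<le> 2 * real s - real q - real k \<Longrightarrow> 1 \<le> s \<and> 2 * q \<le> s"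
  shows "measure_pmf.prob (random_graph n (1/2))
      {G. \<exists>C \<subseteq> {..<n}. clique C (found_graph A G 2) \<and> k \<le> card C}
    \<le> (10 * real k) ^ k * real n powr (\<delta> / 2 * k + (1 - \<delta> / 2) * Y) / 2 ^ (k choose 2) +
      (\<Sum>(s, q) \<in> {(s, q). s \<le> k \<and> q \<le> s \<and> Y \<le> 2 * real s - real q - real k}.
         n * (real n powr \<delta>) ^ (s div 2) * 2 ^ s / 2 ^ ((s choose 2) - (q choose 2)))"
proof -
  let ?E = "nsets {..<n} 2" and ?p = "random_graph n (1/2)"
  let ?I = "{(s, q). s \<le> k \<and> q \<le> s \<and> Y \<le> 2 * real s - real q - real k}"
  define F1 where "F1 = A []"
  define F2 where "F2 H = A [H]" for H
  define c where "c = \<delta> / 2 * k + (1 - \<delta> / 2) * Y"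
  have F1: "F1 \<subseteq> ?E" "real (card F1) \<le> real n powr \<delta>"
    using q[of "{}" 0] by (auto simp: queries_def F1_def)
  have F2: "F2 H \<subseteq> ?E \<and> real (card (F2 H)) \<le> real n powr \<delta>" if "H \<subseteq> F1" for H
  proof -
    \<comment> \<open>On the graph \<open>H\<close> itself the first answers are \<open>H\<close>,
      so the query bounds apply to every possible \<open>F2 H\<close>.\<close>
    have "A [] \<inter> H = H" using that by (auto simp: F1_def)
    then show ?thesis using q[of H 1] that F1 by (auto simp: queries_def F2_def)
  qed
  let ?B1 = "{G. \<exists>K. K \<subseteq> {..<n} \<and> card K = k \<and> cost F1 n \<delta> K \<le> c \<and> nsets K 2 \<subseteq> G}"
  let ?B2 = "\<lambda>(s, q). {G. \<exists>S Q. Q \<subseteq> S \<and> S \<subseteq> {..<n} \<and> card S = s \<and> card Q = q \<and>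
        nsets S 2 - nsets Q 2 \<subseteq> (F2 (F1 \<inter> G) - F1) \<inter> G}"
  have finI: "finite ?I" by (rule finite_subset[of _ "{..k} \<times> {..k}"]) auto
  have "{G. \<exists>C \<subseteq> {..<n}. clique C (found_graph A G 2) \<and> k \<le> card C} \<subseteq> ?B1 \<union> (\<Union>i\<in>?I. ?B2 i)"
  proof
    fix G assume "G \<in> {G. \<exists>C \<subseteq> {..<n}. clique C (found_graph A G 2) \<and> k \<le> card C}"
    then obtain C where C: "C \<subseteq> {..<n}" "clique C (found_graph A G 2)" "k \<le> card C" by blast
    obtain K where K: "K \<subseteq> C" "card K = k" using C(3) obtain_subset_with_card_n by metis
    have Kn: "K \<subseteq> {..<n}" using K C by auto
    then have finK: "finite K" using finite_subset by blast
    have found: "nsets K 2 \<subseteq> (F1 \<inter> G) \<union> (F2 (F1 \<inter> G) \<inter> G)"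
      using clique_imp_nsets_subset[OF smaller_clique[OF C(2) K(1)]]
      by (simp add: found_graph_2 F1_def F2_def)
    show "G \<in> ?B1 \<union> (\<Union>i\<in>?I. ?B2 i)"
    proof (cases "cost F1 n \<delta> K \<le> c")
      case True
      then have "G \<in> ?B1" using Kn K found by blast
      then show ?thesis by blast
    next
      case False
      then have "\<delta> / 2 * card K + (1 - \<delta> / 2) * Y < cost F1 n \<delta> K" using K by (simp add: c_def)
      from expensive_set_partition[OF F1 n Kn \<delta> this]
      obtain P R where PR: "P \<subseteq> K" "R \<subseteq> K" "P \<inter> R = {}" "Y \<le> real (card R) - real (card P)"
        and nb: "\<And>u r. r \<in> R \<Longrightarrow> u \<in> K \<Longrightarrow> {u, r} \<in> F1 \<Longrightarrow> u \<in> P" by metis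
      define S where "S = K - P"
      define Q where "Q = S - R"
      have fin: "finite P" "finite R" "finite S" using finK PR finite_subset S_def by blast+
      have RS: "R \<subseteq> S" using PR by (auto simp: S_def)
      have cards: "card P + card S = k" "card R + card Q = card S"
        using card_Diff_subset[OF fin(1) PR(1)] card_mono[OF finK PR(1)] K
          card_Diff_subset[OF fin(2) RS] card_mono[OF fin(3) RS]
        by (simp_all add: Q_def flip: S_def)
      have "(card S, card Q) \<in> ?I"
      proof -
        have "real (card P) + real (card S) = k" "real (card R) + real (card Q) = card S"
          using cards by (simp_all flip: of_nat_add)
        then have "Y \<le> 2 * real (card S) - card Q - k" using PR(4) by linarith
        then show ?thesis using cards by auto
      qed
      moreover have "nsets S 2 - nsets Q 2 \<subseteq> (F2 (F1 \<inter> G) - F1) \<inter> G"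
      proof
        fix e assume e: "e \<in> nsets S 2 - nsets Q 2"
        then obtain u v where uv: "e = {u, v}" "u \<in> S" "v \<in> S" "v \<notin> Q"
          by (auto simp: nsets_def card_2_iff insert_commute)
        \<comment> \<open>In \<open>F1\<close> the vertex \<open>v\<close> of \<open>R\<close> has
          neighbours in \<open>K\<close> only within \<open>P\<close>, and \<open>u\<close> is
          outside \<open>P\<close>; so the pair was not queried in the first round.\<close>
        then have "v \<in> R" "u \<in> K" "u \<notin> P" by (auto simp: Q_def S_def)
        then have "e \<notin> F1" using nb uv by blast
        moreover have "e \<in> nsets K 2" using e by (auto simp: nsets_def S_def)
        ultimately show "e \<in> (F2 (F1 \<inter> G) - F1) \<inter> G" using found by blast
      qed
      moreover have "Q \<subseteq> S" "S \<subseteq> {..<n}" using Kn by (auto simp: Q_def S_def)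
      ultimately have I: "(card S, card Q) \<in> ?I" and "G \<in> ?B2 (card S, card Q)" by auto
      then have "G \<in> (\<Union>i\<in>?I. ?B2 i)" by (intro UN_I[OF I])
      then show ?thesis by (rule UnI2)
    qed
  qed
  then have "measure_pmf.prob ?p {G. \<exists>C \<subseteq> {..<n}. clique C (found_graph A G 2) \<and> k \<le> card C} \<le>
      measure_pmf.prob ?p (?B1 \<union> (\<Union>i\<in>?I. ?B2 i))"
    by (intro measure_pmf.finite_measure_mono) auto
  also have "\<dots> \<le> measure_pmf.prob ?p ?B1 + measure_pmf.prob ?p (\<Union>i\<in>?I. ?B2 i)"
    by (rule measure_Un_le) auto
  also have "\<dots> \<le> measure_pmf.prob ?p ?B1 + (\<Sum>i\<in>?I. measure_pmf.prob ?p (?B2 i))"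
    using finI by (intro add_left_mono measure_UNION_le) auto
  also have "\<dots> \<le> (10 * real k) ^ k * real n powr c / 2 ^ (k choose 2) +
      (\<Sum>(s, q) \<in> ?I. n * (real n powr \<delta>) ^ (s div 2) * 2 ^ s / 2 ^ ((s choose 2) - (q choose 2)))"
  proof (intro add_mono sum_mono)
    show "measure_pmf.prob ?p ?B1 \<le> (10 * real k) ^ k * real n powr c / 2 ^ (k choose 2)"
      by (rule prob_cheap_clique_le[OF F1 n k])
    fix i assume i: "i \<in> ?I"
    obtain s q where sq: "i = (s, q)" by (cases i)
    show "measure_pmf.prob ?p (?B2 i) \<le> (case i of (s, q) \<Rightarrow>
        n * (real n powr \<delta>) ^ (s div 2) * 2 ^ s / 2 ^ ((s choose 2) - (q choose 2)))"
      unfolding sq prod.case using small[of s q] i sq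
      by (intro prob_second_round_le[OF F1(1) F2]) auto
  qed
  finally show ?thesis by (simp only: c_def)
qed

section \<open>Asymptotics\<close>

lemma real_choose_2: "real (k choose 2) = real k * (real k - 1) / 2"
  by (cases k) (auto simp: choose_two field_simps real_of_nat_div)

text \<open>The exponent of \<open>n\<close> equals
  \<open>k - (2 - \<delta>)\<^sup>2 / 2 * L\<close>, which makes \<open>- c * L\<^sup>2\<close> the
  main term. Since \<open>1 - (2 - \<delta>)\<^sup>2 = (\<delta> - 1) * (3 - \<delta>)\<close>, in
  the range of the theorem \<open>c > 0\<close> amounts to
  \<open>\<alpha> > 1 + sqrt ((\<delta> - 1) * (3 - \<delta>))\<close>.\<close>

lemma cheap_clique_bound_le:
  fixes L \<alpha> \<delta> c :: real
  assumes n: "2 \<le> n" and L: "L = log 2 n" and k: "1 \<le> k" "\<alpha> * L \<le> k" "real k \<le> 2 * L + 1" and \<alpha>: "1 \<le> \<alpha>"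
    and c: "c = (\<alpha>\<^sup>2 - 2 * \<alpha> + (2 - \<delta>)\<^sup>2) / 2"
  shows "(10 * real k) ^ k * real n powr (\<delta> / 2 * k + (1 - \<delta> / 2) * (k - (2 - \<delta>) * L)) / 2 ^ (k choose 2)
    \<le> 2 powr ((2 * L + 1) * log 2 (10 * (2 * L + 1)) + (2 * L + 1) / 2 - c * L\<^sup>2)"
proof -
  have L1: "1 \<le> L" using n by (simp add: L le_log_iff)
  have nL: "real n = 2 powr L" using n by (simp add: L)
  have "(10 * real k) ^ k = 2 powr (k * log 2 (10 * real k))"
    using k(1) by (subst mult.commute) (simp add: powr_powr[symmetric] powr_realpow)
  moreover have "real n powr (\<delta> / 2 * k + (1 - \<delta> / 2) * (k - (2 - \<delta>) * L)) =
      2 powr (L * k - (2 - \<delta>)\<^sup>2 / 2 * L\<^sup>2)"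
    unfolding nL powr_powr by (rule arg_cong[where f="\<lambda>x. 2 powr x"]) (simp add: field_simps power2_eq_square)
  moreover have "2 ^ (k choose 2) = 2 powr (real k * (real k - 1) / 2)"
    unfolding real_choose_2[symmetric] by (simp add: powr_realpow)
  ultimately have "(10 * real k) ^ k * real n powr (\<delta> / 2 * k + (1 - \<delta> / 2) * (k - (2 - \<delta>) * L)) / 2 ^ (k choose 2)
     = 2 powr (k * log 2 (10 * real k) + (L * k - (2 - \<delta>)\<^sup>2 / 2 * L\<^sup>2) - real k * (real k - 1) / 2)"
    by (simp add: powr_add powr_diff)
  also have "\<dots> \<le> 2 powr ((2 * L + 1) * log 2 (10 * (2 * L + 1)) + (2 * L + 1) / 2 - c * L\<^sup>2)"
  proof (rule powr_mono)
    have lin: "x \<le> x' \<Longrightarrow> y - z \<le> t / 2 - e \<Longrightarrow> t \<le> t' \<Longrightarrow> x + y - z \<le> x' + t' / 2 - e"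
      for x x' y z t t' e :: real by linarith
    have "k * log 2 (10 * real k) \<le> (2 * L + 1) * log 2 (10 * (2 * L + 1))"
      using k L1 by (intro mult_mono) auto
    \<comment> \<open>The product is \<open>k\<^sup>2 - 2 * k * L - (\<alpha>\<^sup>2 - 2 *
      \<alpha>) * L\<^sup>2\<close> in factored form.\<close>
    moreover have "0 \<le> (k - \<alpha> * L) * (k + \<alpha> * L - 2 * L)"
    proof (rule mult_nonneg_nonneg)
      have "1 * L \<le> \<alpha> * L" using \<alpha> L1 by (intro mult_right_mono) auto
      then show "0 \<le> k + \<alpha> * L - 2 * L" using k by linarith
    qed (use k in simp)
    then have "(\<alpha>\<^sup>2 - 2 * \<alpha>) * L\<^sup>2 \<le> real k * real k - 2 * k * L"
      by (simp add: algebra_simps power2_eq_square)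
    then have "L * k - (2 - \<delta>)\<^sup>2 / 2 * L\<^sup>2 - real k * (real k - 1) / 2 \<le> k / 2 - c * L\<^sup>2"
      unfolding c by (simp add: field_simps)
    ultimately show "k * log 2 (10 * real k) + (L * k - (2 - \<delta>)\<^sup>2 / 2 * L\<^sup>2) - real k * (real k - 1) / 2
      \<le> (2 * L + 1) * log 2 (10 * (2 * L + 1)) + (2 * L + 1) / 2 - c * L\<^sup>2"
      using k(3) lin by blast
  qed simp
  finally show ?thesis .
qed

text \<open>The assumptions give \<open>s \<ge> (\<delta> + \<zeta>) * L + q / 2\<close> and
  \<open>q \<le> (2 - \<delta>) * L\<close>. From \<open>\<delta> > 6 / 5\<close> follows
  \<open>q \<le> 4 / 5 * L\<close>, hence
  \<open>\<delta> * L * q / 2 \<ge> 3 / 4 * q\<^sup>2\<close>, just enough to absorb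
  \<open>q\<^sup>2\<close> in the last conclusion.\<close>

lemma second_round_sizes:
  fixes L \<delta> \<zeta> k s q :: real
  assumes L: "0 < L" and \<delta>: "6 / 5 < \<delta>" "\<delta> < 2" and \<zeta>: "0 < \<zeta>"
    and k: "(1 + \<delta> / 2 + \<zeta>) * L \<le> k" and q: "0 \<le> q" "s \<le> k" "k - (2 - \<delta>) * L \<le> 2 * s - q - k"
  shows "0 < s" "2 * q \<le> s" "\<zeta> * L\<^sup>2 \<le> s\<^sup>2 - q\<^sup>2 - \<delta> * s * L"
proof -
  have dL: "6 / 5 * L \<le> \<delta> * L" and zL: "0 < \<zeta> * L" using \<delta> L \<zeta> by auto
  have s: "\<delta> * L + \<zeta> * L + q / 2 \<le> s"
    using k q by (simp add: algebra_simps)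
  have q2: "q \<le> (2 - \<delta>) * L" using q by linarith
  then have q3: "q \<le> 4 / 5 * L" using dL by (simp add: algebra_simps)
  show s0: "0 < s" using s zL dL L q by linarith
  show "2 * q \<le> s" using s q3 dL zL by linarith
  \<comment> \<open>Product of the bounds \<open>s \<ge> \<delta> * L + q / 2\<close> and
    \<open>s - \<delta> * L \<ge> \<zeta> * L + q / 2\<close>.\<close>
  have "(\<delta> * L + q / 2) * (\<zeta> * L + q / 2) \<le> s * (s - \<delta> * L)"
    using s zL dL L q s0 by (intro mult_mono) auto
  moreover have "(\<delta> * L + q / 2) * (\<zeta> * L + q / 2) = \<delta> * L * (\<zeta> * L) + \<delta> * L * q / 2 + q / 2 * (\<zeta> * L) + q * q / 4"
    by (simp add: algebra_simps)
  moreover have "1 * L * (\<zeta> * L) \<le> \<delta> * L * (\<zeta> * L)" using \<delta> zL L by (intro mult_right_mono) auto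
  moreover have "0 \<le> q / 2 * (\<zeta> * L)" using q zL by auto
  moreover have "6 / 5 * L * q \<le> \<delta> * L * q" by (rule mult_right_mono[OF dL q(1)])
  moreover have "q * q \<le> 4 / 5 * L * q" using q3 q by (intro mult_right_mono) auto
  ultimately have "L * (\<zeta> * L) \<le> s * (s - \<delta> * L) - q * q" by linarith
  then show "\<zeta> * L\<^sup>2 \<le> s\<^sup>2 - q\<^sup>2 - \<delta> * s * L" by (simp add: algebra_simps power2_eq_square)
qed

text \<open>The quadratic part of the exponent is half of
  \<open>\<delta> * s * L - (s\<^sup>2 - q\<^sup>2)\<close>; the terms linear in \<open>L\<close>,
  \<open>s\<close> and \<open>q\<close> are collected in \<open>L + 2 * (2 * L + 1)\<close>.\<close>

lemma second_round_bound_le: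
  fixes L \<delta> \<zeta> :: real
  assumes n: "2 \<le> n" and L: "L = log 2 n" and \<delta>: "0 < \<delta>"
    and s: "real s \<le> 2 * L + 1" "q \<le> s" "\<zeta> * L\<^sup>2 \<le> (real s)\<^sup>2 - (real q)\<^sup>2 - \<delta> * s * L"
  shows "n * (real n powr \<delta>) ^ (s div 2) * 2 ^ s / 2 ^ ((s choose 2) - (q choose 2))
    \<le> 2 powr (L + 2 * (2 * L + 1) - \<zeta> * L\<^sup>2 / 2)"
proof -
  have L1: "1 \<le> L" using n by (simp add: L le_log_iff)
  have nL: "real n = 2 powr L" using n by (simp add: L)
  have "(real n powr \<delta>) ^ (s div 2) = 2 powr (L * \<delta> * real (s div 2))"
    unfolding nL powr_powr by (simp add: powr_powr[symmetric] powr_realpow)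
  also have "\<dots> \<le> 2 powr (L * \<delta> * (s / 2))"
    using L1 \<delta> by (intro powr_mono mult_left_mono) auto
  finally have 1: "(real n powr \<delta>) ^ (s div 2) \<le> 2 powr (L * \<delta> * (s / 2))" .
  have 2: "2 ^ ((s choose 2) - (q choose 2)) = 2 powr (real s * (real s - 1) / 2 - real q * (real q - 1) / 2)"
  proof -
    have "q choose 2 \<le> s choose 2" using s(2) by (rule binomial_right_mono)
    then have "real ((s choose 2) - (q choose 2)) = real s * (real s - 1) / 2 - real q * (real q - 1) / 2"
      by (simp add: of_nat_diff real_choose_2)
    then show ?thesis by (simp add: powr_realpow[symmetric])
  qed
  have "n * (real n powr \<delta>) ^ (s div 2) * 2 ^ s / 2 ^ ((s choose 2) - (q choose 2))
    \<le> 2 powr L * 2 powr (L * \<delta> * (s / 2)) * 2 powr s / 2 ^ ((s choose 2) - (q choose 2))"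
    using 1 nL by (intro divide_right_mono mult_mono) (auto simp: powr_realpow)
  also have "\<dots> = 2 powr (L + L * \<delta> * (s / 2) + s - (real s * (real s - 1) / 2 - real q * (real q - 1) / 2))"
    unfolding 2 by (simp add: powr_add powr_diff)
  also have "\<dots> \<le> 2 powr (L + 2 * (2 * L + 1) - \<zeta> * L\<^sup>2 / 2)"
  proof (rule powr_mono)
    have lin: "x - z = (t - r) / 2 - w / 2 \<Longrightarrow> 0 \<le> r \<Longrightarrow> 0 \<le> t \<Longrightarrow> t \<le> t' \<Longrightarrow> e \<le> w \<Longrightarrow>
        L + x + t - z \<le> L + 2 * t' - e / 2" for x z t t' r w e :: real
      by (simp add: field_simps)
    have "L * \<delta> * (s / 2) - (real s * (real s - 1) / 2 - real q * (real q - 1) / 2) =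
      (s - real q) / 2 - ((real s)\<^sup>2 - (real q)\<^sup>2 - \<delta> * s * L) / 2"
      by (simp add: field_simps power2_eq_square)
    then show "L + L * \<delta> * (s / 2) + s - (real s * (real s - 1) / 2 - real q * (real q - 1) / 2)
       \<le> L + 2 * (2 * L + 1) - \<zeta> * L\<^sup>2 / 2"
      using lin[OF _ of_nat_0_le_iff of_nat_0_le_iff s(1,3)] by blast
  qed simp
  finally show ?thesis .
qed

text \<open>The first summand is for cheap cliques. In the second,
  \<open>(2 * L + 2)\<^sup>2\<close> bounds the number of pairs \<open>(s, q)\<close> when
  \<open>k \<le> 2 * L + 1\<close>.\<close>

definition failure_bound :: "real \<Rightarrow> real \<Rightarrow> real \<Rightarrow> real" where
  "failure_bound c \<zeta> L = 2 powr ((2 * L + 1) * log 2 (10 * (2 * L + 1)) + (2 * L + 1) / 2 - c * L\<^sup>2) +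
     (2 * L + 2)\<^sup>2 * 2 powr (L + 2 * (2 * L + 1) - \<zeta> * L\<^sup>2 / 2)"

lemma failure_bound_tendsto_0:
  assumes "0 < c" "0 < \<zeta>"
  shows "(failure_bound c \<zeta> \<longlongrightarrow> 0) at_top"
  unfolding failure_bound_def
proof (rule tendsto_add_zero)
  have "filterlim (\<lambda>L. (2 * L + 1) * log 2 (10 * (2 * L + 1)) + (2 * L + 1) / 2 - c * L\<^sup>2) at_bot at_top"
    using assms(1) by real_asymp
  moreover have "((\<lambda>x. 2 powr x) \<longlongrightarrow> (0::real)) at_bot" by real_asymp
  ultimately show "((\<lambda>L. 2 powr ((2 * L + 1) * log 2 (10 * (2 * L + 1)) + (2 * L + 1) / 2 - c * L\<^sup>2)) \<longlongrightarrow> 0) at_top"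
    by (rule filterlim_compose[rotated])
  show "((\<lambda>L. (2 * L + 2)\<^sup>2 * 2 powr (L + 2 * (2 * L + 1) - \<zeta> * L\<^sup>2 / 2)) \<longlongrightarrow> 0) at_top"
    using assms(2) by real_asymp
qed

section \<open>Ruling out large cliques for large \<open>n\<close>\<close>

lemma prob_clique_mono:
  fixes a b :: real
  assumes "a \<le> b"
  shows "measure_pmf.prob (random_graph n (1/2)) {G. \<exists>C \<subseteq> {..<n}. clique C (f G) \<and> b \<le> card C}
    \<le> measure_pmf.prob (random_graph n (1/2)) {G. \<exists>C \<subseteq> {..<n}. clique C (f G) \<and> a \<le> card C}"
  by (intro measure_pmf.finite_measure_mono Collect_mono) (use assms order_trans in \<open>blast, simp\<close>)

lemma prob_large_clique_le:
  fixes A :: strategy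
  assumes q: "\<And>G i. G \<subseteq> nsets {..<n} 2 \<Longrightarrow> i < 2 \<Longrightarrow>
        queries A G i \<subseteq> nsets {..<n} 2 \<and> real (card (queries A G i)) \<le> real n powr \<delta>"
    and n: "2 \<le> n" and \<delta>: "6 / 5 < \<delta>" "\<delta> < 2" and \<alpha>: "\<alpha> \<le> 2" "0 < \<zeta>" "1 + \<delta> / 2 + \<zeta> = \<alpha>"
  shows "measure_pmf.prob (random_graph n (1/2))
      {G. \<exists>C \<subseteq> {..<n}. clique C (found_graph A G 2) \<and> \<alpha> * log 2 n + 1 \<le> card C}
    \<le> failure_bound ((\<alpha>\<^sup>2 - 2 * \<alpha> + (2 - \<delta>)\<^sup>2) / 2) \<zeta> (log 2 n)"
proof -
  define L where "L = log 2 (real n)"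
  \<comment> \<open>Rounding up adds at most 1, which is the 1 in the clique size of the
    statement.\<close>
  define k where "k = nat \<lceil>\<alpha> * L\<rceil>"
  \<comment> \<open>Together with \<open>s \<le> k\<close> this choice forces
    \<open>q \<le> (2 - \<delta>) * L\<close>, and it turns the cheap cost bound into
    \<open>k - (2 - \<delta>)\<^sup>2 / 2 * L\<close>.\<close>
  define Y where "Y = k - (2 - \<delta>) * L"
  let ?I = "{(s, q). s \<le> k \<and> q \<le> s \<and> Y \<le> 2 * real s - real q - real k}"
  let ?t = "2 powr (L + 2 * (2 * L + 1) - \<zeta> * L\<^sup>2 / 2)"
  have L1: "1 \<le> L" using n by (simp add: L_def le_log_iff)
  have "1 * 1 \<le> \<alpha> * L" using \<alpha> \<delta> L1 by (intro mult_mono) auto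
  then have k: "\<alpha> * L \<le> k" "k \<le> \<alpha> * L + 1" "1 \<le> k" unfolding k_def by linarith+
  have "\<alpha> * L \<le> 2 * L" using \<alpha> L1 by (intro mult_right_mono) auto
  then have k2: "real k \<le> 2 * L + 1" using k by linarith
  have sizes: "0 < real s" "2 * real q \<le> real s" "\<zeta> * L\<^sup>2 \<le> (real s)\<^sup>2 - (real q)\<^sup>2 - \<delta> * s * L"
    if "s \<le> k" "Y \<le> 2 * real s - real q - real k" for s q :: nat
    using second_round_sizes[of L \<delta> \<zeta> "real k" "real q" "real s"] that k \<delta> \<alpha> L1 by (simp_all add: Y_def)
  have finI: "finite ?I" by (rule finite_subset[of _ "{..k} \<times> {..k}"]) auto
  have cI: "real (card ?I) \<le> (2 * L + 2)\<^sup>2"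
  proof -
    have "card ?I \<le> card ({..k} \<times> {..k})" by (intro card_mono) auto
    then have "card ?I \<le> (k + 1)\<^sup>2" by (simp add: card_cartesian_product power2_eq_square)
    then have "real (card ?I) \<le> (real k + 1)\<^sup>2" using of_nat_mono[of "card ?I" "(k + 1)\<^sup>2"] by (simp add: add.commute)
    also have "\<dots> \<le> (2 * L + 2)\<^sup>2" using k2 by (intro power_mono) auto
    finally show ?thesis .
  qed
  have "measure_pmf.prob (random_graph n (1/2))
      {G. \<exists>C \<subseteq> {..<n}. clique C (found_graph A G 2) \<and> \<alpha> * L + 1 \<le> card C} \<le>
    measure_pmf.prob (random_graph n (1/2))
      {G. \<exists>C \<subseteq> {..<n}. clique C (found_graph A G 2) \<and> k \<le> card C}"
    using prob_clique_mono[of "real k" "\<alpha> * L + 1" n "\<lambda>G. found_graph A G 2"] k(2) by simp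
  also have "\<dots> \<le> (10 * real k) ^ k * real n powr (\<delta> / 2 * k + (1 - \<delta> / 2) * Y) / 2 ^ (k choose 2) +
      (\<Sum>(s, q) \<in> ?I. n * (real n powr \<delta>) ^ (s div 2) * 2 ^ s / 2 ^ ((s choose 2) - (q choose 2)))"
  proof (rule prob_two_round_clique_le[OF q n k(3) \<delta>(2)])
    fix s q :: nat assume sq: "s \<le> k" "Y \<le> 2 * real s - real q - real k"
    show "1 \<le> s \<and> 2 * q \<le> s" using sizes(1,2)[OF sq] by linarith
  qed
  also have "\<dots> \<le> 2 powr ((2 * L + 1) * log 2 (10 * (2 * L + 1)) + (2 * L + 1) / 2
      - ((\<alpha>\<^sup>2 - 2 * \<alpha> + (2 - \<delta>)\<^sup>2) / 2) * L\<^sup>2) + (\<Sum>i\<in>?I. ?t)"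
  proof (intro add_mono sum_mono)
    show "(10 * real k) ^ k * real n powr (\<delta> / 2 * k + (1 - \<delta> / 2) * Y) / 2 ^ (k choose 2)
      \<le> 2 powr ((2 * L + 1) * log 2 (10 * (2 * L + 1)) + (2 * L + 1) / 2
      - ((\<alpha>\<^sup>2 - 2 * \<alpha> + (2 - \<delta>)\<^sup>2) / 2) * L\<^sup>2)"
      unfolding Y_def using \<alpha> \<delta> k k2 by (intro cheap_clique_bound_le n) (auto simp: L_def)
    fix i assume "i \<in> ?I"
    then obtain s q where i: "i = (s, q)" "s \<le> k" "q \<le> s" "Y \<le> 2 * real s - real q - real k" by auto
    show "(case i of (s, q) \<Rightarrow> n * (real n powr \<delta>) ^ (s div 2) * 2 ^ s / 2 ^ ((s choose 2) - (q choose 2))) \<le> ?t"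
      unfolding i(1) prod.case using i sizes(3)[OF i(2,4)] k2 \<delta>
      by (intro second_round_bound_le n) (auto simp: L_def)
  qed
  also have "\<dots> \<le> failure_bound ((\<alpha>\<^sup>2 - 2 * \<alpha> + (2 - \<delta>)\<^sup>2) / 2) \<zeta> L"
    unfolding failure_bound_def using cI by (simp add: mult_right_mono)
  finally show ?thesis by (simp only: L_def)
qed

text \<open>The difference of the squares is \<open>(5 * \<delta> - 6) * (2 - \<delta>) / 4\<close>.
  Thus a coefficient beyond the claimed bound also exceeds \<open>1 + \<delta> / 2\<close>, as the
  second-round estimate requires.\<close>

lemma sqrt_bound_ge:
  fixes \<delta> :: real
  assumes "6 / 5 < \<delta>" "\<delta> < 2"
  shows "\<delta> / 2 \<le> sqrt ((\<delta> - 1) * (3 - \<delta>))"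
proof (rule real_le_rsqrt)
  have "0 \<le> (5 * \<delta> - 6) * (2 - \<delta>)" using assms by (intro mult_nonneg_nonneg) auto
  then show "(\<delta> / 2)\<^sup>2 \<le> (\<delta> - 1) * (3 - \<delta>)" by (simp add: field_simps power2_eq_square)
qed

theorem theorem2:
  fixes \<delta> :: real
  assumes "6 / 5 < \<delta>" and "\<delta> < 2"
  shows "alpha_star \<delta> 2 \<le> 1 + sqrt ((\<delta> - 1) * (3 - \<delta>))"
  unfolding alpha_star_def
proof (rule cSup_least[OF alpha_star_set_nonempty], rule ccontr)
  let ?r = "sqrt ((\<delta> - 1) * (3 - \<delta>))"
  fix \<alpha> assume "\<alpha> \<in> {\<alpha>. \<alpha> \<le> 2 \<and> (\<exists>A. clique_algorithm \<delta> 2 \<alpha> A)}" and gt: "\<not> \<alpha> \<le> 1 + ?r"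
  then obtain A where \<alpha>: "\<alpha> \<le> 2" and A: "clique_algorithm \<delta> 2 \<alpha> A" by auto
  \<comment> \<open>The gap \<open>\<alpha> - \<beta>\<close> makes room for the error
    \<open>h n\<close> and for the additive 1, half of it for each.\<close>
  define \<beta> where "\<beta> = (\<alpha> + (1 + ?r)) / 2"
  define \<zeta> where "\<zeta> = \<beta> - (1 + \<delta> / 2)"
  define c where "c = (\<beta>\<^sup>2 - 2 * \<beta> + (2 - \<delta>)\<^sup>2) / 2"
  have \<beta>: "1 + ?r < \<beta>" "\<beta> < \<alpha>" using gt by (auto simp: \<beta>_def)
  have r: "\<delta> / 2 \<le> ?r" using sqrt_bound_ge assms by simp
  have \<zeta>: "0 < \<zeta>" using \<beta> r by (simp add: \<zeta>_def)
  have "?r\<^sup>2 < (\<beta> - 1)\<^sup>2" using \<beta> r assms by (intro power_strict_mono) auto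
  moreover have "?r\<^sup>2 = (\<delta> - 1) * (3 - \<delta>)" using assms by simp
  ultimately have c: "0 < c" by (simp add: c_def power2_eq_square algebra_simps)
  obtain h where h: "h \<in> o(\<lambda>n. log 2 (real n))"
    and ev: "\<forall>\<^sub>F n in sequentially. 1 / 2 \<le> measure_pmf.prob (random_graph n (1/2))
         {G. \<exists>C \<subseteq> {..<n}. clique C (found_graph (A n) G 2) \<and> real (card C) \<ge> \<alpha> * log 2 (real n) - h n}"
    using A[unfolded clique_algorithm_def, THEN conjunct2] by (elim exE conjE)
  note q = A[unfolded clique_algorithm_def, THEN conjunct1, rule_format]
  have lim: "filterlim (\<lambda>n. log 2 (real n)) at_top sequentially" by real_asymp
  have "\<forall>\<^sub>F L in at_top. failure_bound c \<zeta> L < 1 / 2"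
    using order_tendstoD(2)[OF failure_bound_tendsto_0[OF c \<zeta>], of "1 / 2"] by simp
  then have fb: "\<forall>\<^sub>F n in sequentially. failure_bound c \<zeta> (log 2 (real n)) < 1 / 2"
    using lim by (rule eventually_compose_filterlim)
  have "\<forall>\<^sub>F n in sequentially. norm (h n) \<le> (\<alpha> - \<beta>) / 2 * norm (log 2 (real n))"
    using landau_o.smallD[OF h, of "(\<alpha> - \<beta>) / 2"] \<beta> by simp
  moreover have "\<forall>\<^sub>F n in sequentially. 2 / (\<alpha> - \<beta>) \<le> log 2 (real n)"
    using lim by (simp add: filterlim_at_top)
  ultimately have "\<forall>\<^sub>F n in sequentially. False"
    using ev fb eventually_ge_at_top[of 2]
  proof eventually_elim
    case (elim n)
    let ?L = "log 2 (real n)"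
    have "0 \<le> ?L" using elim(5) by simp
    then have "h n \<le> (\<alpha> - \<beta>) / 2 * ?L" using elim(1) by (simp add: abs_le_iff)
    moreover have "1 \<le> (\<alpha> - \<beta>) / 2 * ?L" using elim(2) \<beta> by (simp add: field_simps)
    ultimately have le: "\<beta> * ?L + 1 \<le> \<alpha> * ?L - h n" by (simp add: field_simps)
    have "1 / 2 \<le> measure_pmf.prob (random_graph n (1/2))
        {G. \<exists>C \<subseteq> {..<n}. clique C (found_graph (A n) G 2) \<and> \<beta> * ?L + 1 \<le> card C}"
      by (rule order_trans[OF elim(3) prob_clique_mono[OF le]])
    also have "\<dots> \<le> failure_bound c \<zeta> ?L"
      unfolding c_def using elim(5) assms \<alpha> \<beta> \<zeta>
      by (intro prob_large_clique_le q) (auto simp: \<zeta>_def)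
    finally show False using elim(4) by simp
  qed
  then show False by simp
qed

end
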